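(* Consider minimizing $\Phi(x)=f(g(x))+h(x)$ over $x\in\mathbb{R}^n$ with $g(x)=\frac1N\sum_{j=1}^N g_j(x)$, where: $f:\mathbb{R}^m\to\mathbb{R}\cup\{+\infty\}$ is convex and $\ell_f$-Lipschitz continuous, i.e. $|f(u)-f(v)|\le\ell_f\|u-v\|$ for all $u,v\in\mathbb{R}^m$; $h:\mathbb{R}^n\to\mathbb{R}\cup\{+\infty\}$ is convex and lower semicontinuous; each smooth mapping $g_j:\mathbb{R}^n\to\mathbb{R}^m$, with Jacobian $g_j'$, satisfies $\|g_j(x)-g_j(y)\|\le \ell_{g,j}\|x-y\|$ and $\|g_j'(x)-g_j'(y)\|\le L_{g,j}\|x-y\|$ for all $x,y\in\operatorname{dom}h$; and $\Phi_*=\inf_x\Phi(x)>-\infty$. Let $L_g=\bigl(\frac1N\sum_{j=1}^N L_{g,j}^2\bigr)^{1/2}$. Run the SVR-PL algorithm with first-order corrected SVRG estimators (defined in the context) with $M\ge 4\ell_f L_g$, $\tau=\lceil\frac12N^{1/5}-1\rceil$, and batch sizes $$|\mathcal{B}_i^k|=\lceil 4N^{4/5}\rceil,\qquad |\mathcal{S}_i^k|=\lceil N^{2/5}\rceil,\qquad i=1,\dots,\tau-1,\ k=1,\dots,K.$$ Then the output $x_{i^*}^{k^*}$ satisfies $$\mathbb{E}\bigl[\|\mathcal{G}(x_{i^*}^{k^*})\|^2\bigr]\le\frac{15M\bigl(\Phi(x_0^1)-\Phi_*\bigr)}{K\tau}.$$ To get an $\epsilon$-stationary point in expectation (that is, an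 output with $\mathbb{E}[\|\mathcal{G}(x_{i^*}^{k^*})\|^2]\le\epsilon$), the total sample complexities for the component mappings $g_j$ and for their Jacobians $g_j'$ (total numbers of evaluations) are both $O(N+N^{4/5}\epsilon^{-1})$.
   Context: $\|\cdot\|$ is the Euclidean norm for vectors and the spectral norm for matrices; $g'$ denotes the Jacobian of $g$; $\lceil\cdot\rceil$ denotes rounding up to the nearest integer. Gradient mapping: for $x\in\operatorname{dom}h$, $\mathcal{G}(x)=M(x-x_+)$ with $x_+=\operatorname{argmin}_y\{f(g(x)+g'(x)(y-x))+h(y)+\frac M2\|y-x\|^2\}$. SVR-PL algorithm: the input is an initial point $x_0^1$, a parameter $M>0$, and the numbers $K$ and $\tau$ of outer and inner iterations. For $k=1,\dots,K$ and $i=0,\dots,\tau-1$, compute estimates $\tilde g_i^k\in\mathbb{R}^m$ and $\tilde J_i^k\in\mathbb{R}^{m\times n}$ and set $$x_{i+1}^k=\operatorname{argmin}_x\Bigl\{f\bigl(\tilde g_i^k+\tilde J_i^k(x-x_i^k)\bigr)+h(x)+\tfrac M2\|x-x_i^k\|^2\Bigr\};$$ at the end of epoch $k$ set $x_0^{k+1}=x_\tau^k$. The output $x_{i^*}^{k^*}$ is chosen uniformly at random from $\{x_i^k: k=1,\dots,K,\ i=0,\dots,\tau-1\}$. First-order corrected SVRG estimators: $\tilde g_0^k=g(x_0^k)$, $\tilde J_0^k=g'(x_0^k)$ (full averages over all $N$ components), and for $i\ge1$ $$\tilde g_i^k=\frac1{|\mathcal{B}_i^k|}\sum_{j\in\mathcal{B}_i^k}\bigl(g_j(x_i^k)-g_j(x_0^k)-g_j'(x_0^k)(x_i^k-x_0^k)\bigr)+g(x_0^k)+g'(x_0^k)(x_i^k-x_0^k),$$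 $$\tilde J_i^k=\frac1{|\mathcal{S}_i^k|}\sum_{j\in\mathcal{S}_i^k}\bigl(g_j'(x_i^k)-g_j'(x_0^k)\bigr)+g'(x_0^k),$$ where $\mathcal{B}_i^k$ and $\mathcal{S}_i^k$ consist of indices sampled uniformly at random with replacement from $\{1,\dots,N\}$, independently between iterations; within one iteration $\mathcal{B}_i^k$ and $\mathcal{S}_i^k$ may be dependent. The expectation is over all random sampling and the random choice of output. *)

theory Defs
  imports "HOL-Probability.Probability"
begin

text \<open>
  Functions with values in \<open>\<real> \<union> {+\<infinity>}\<close> are modelled as functions into \<^typ>\<open>ereal\<close>
  that never take the value \<open>-\<infinity>\<close>; \<^const>\<open>convex_on\<close> covers real-valued functions only.
\<close>

definition ereal_convex :: "('a::real_vector \<Rightarrow> ereal) \<Rightarrow> bool" where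
  "ereal_convex \<phi> \<longleftrightarrow>
     (\<forall>x y t. 0 < t \<and> t < 1 \<longrightarrow>
        \<phi> ((1 - t) *\<^sub>R x + t *\<^sub>R y) \<le> ereal (1 - t) * \<phi> x + ereal t * \<phi> y)"

definition ereal_lsc :: "('a::topological_space \<Rightarrow> ereal) \<Rightarrow> bool" where
  "ereal_lsc \<phi> \<longleftrightarrow> (\<forall>x. \<phi> x \<le> Liminf (at x) \<phi>)"

definition edom :: "('a \<Rightarrow> ereal) \<Rightarrow> 'a set" where
  "edom \<phi> = {x. \<phi> x < \<infinity>}"

text \<open>
  The library norm on \<^typ>\<open>real^'n^'m\<close> is the Frobenius norm; the spectral norm is the operator
  norm with respect to the Euclidean norms.
\<close>

definition spectral_norm :: "real^'n^'m \<Rightarrow> real" where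
  "spectral_norm A = onorm (\<lambda>v. A *v v)"

definition avg_map :: "nat \<Rightarrow> (nat \<Rightarrow> real^'n \<Rightarrow> real^'m) \<Rightarrow> real^'n \<Rightarrow> real^'m" where
  "avg_map N g x = (1 / real N) *\<^sub>R (\<Sum>j = 1..N. g j x)"

abbreviation jac :: "(real^'n \<Rightarrow> real^'m) \<Rightarrow> real^'n \<Rightarrow> real^'n^'m" where
  "jac g x \<equiv> jacobian g (at x)"

definition objective ::
  "nat \<Rightarrow> (real^'m \<Rightarrow> ereal) \<Rightarrow> (real^'n \<Rightarrow> ereal) \<Rightarrow> (nat \<Rightarrow> real^'n \<Rightarrow> real^'m) \<Rightarrow> real^'n \<Rightarrow> ereal"
  where "objective N f h g x = f (avg_map N g x) + h x"

definition optimal_value ::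
  "nat \<Rightarrow> (real^'m \<Rightarrow> ereal) \<Rightarrow> (real^'n \<Rightarrow> ereal) \<Rightarrow> (nat \<Rightarrow> real^'n \<Rightarrow> real^'m) \<Rightarrow> ereal"
  where "optimal_value N f h g = (INF x. objective N f h g x)"

definition prox_linear ::
  "(real^'m \<Rightarrow> ereal) \<Rightarrow> (real^'n \<Rightarrow> ereal) \<Rightarrow> real \<Rightarrow> real^'m \<Rightarrow> real^'n^'m \<Rightarrow> real^'n \<Rightarrow> real^'n"
  where "prox_linear f h M u J x =
    (ARG_MIN (\<lambda>y. f (u + J *v (y - x)) + h y + ereal (M / 2 * (norm (y - x))\<^sup>2)) y. True)"

definition grad_map ::
  "nat \<Rightarrow> (real^'m \<Rightarrow> ereal) \<Rightarrow> (real^'n \<Rightarrow> ereal) \<Rightarrow> (nat \<Rightarrow> real^'n \<Rightarrow> real^'m) \<Rightarrow> real \<Rightarrow>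
   real^'n \<Rightarrow> real^'n"
  where "grad_map N f h g M x =
    M *\<^sub>R (x - prox_linear f h M (avg_map N g x) (jac (avg_map N g) x) x)"

text \<open>
  A batch drawn with replacement is a list of indices; \<open>a\<close> is the first iterate of the epoch and
  \<open>x\<close> the current iterate.
\<close>

definition svrg_map_est ::
  "nat \<Rightarrow> (nat \<Rightarrow> real^'n \<Rightarrow> real^'m) \<Rightarrow> nat list \<Rightarrow> real^'n \<Rightarrow> real^'n \<Rightarrow> real^'m" where
  "svrg_map_est N g b a x =
     (1 / real (length b)) *\<^sub>R (\<Sum>j\<leftarrow>b. g j x - g j a - jac (g j) a *v (x - a))
     + avg_map N g a + jac (avg_map N g) a *v (x - a)"

definition svrg_jac_est ::
  "nat \<Rightarrow> (nat \<Rightarrow> real^'n \<Rightarrow> real^'m) \<Rightarrow> nat list \<Rightarrow> real^'n \<Rightarrow> real^'n \<Rightarrow> real^'n^'m" where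
  "svrg_jac_est N g s a x =
     (1 / real (length s)) *\<^sub>R (\<Sum>j\<leftarrow>s. jac (g j) x - jac (g j) a) + jac (avg_map N g) a"

text \<open>
  \<open>svr_inner N f h g M a bs i\<close> is the \<open>i\<close>-th iterate of an epoch started at \<open>a\<close>, where
  \<open>bs i\<close> is the pair of batches (for the map and for the Jacobian) of iteration \<open>i \<ge> 1\<close>.
\<close>

primrec svr_inner ::
  "nat \<Rightarrow> (real^'m \<Rightarrow> ereal) \<Rightarrow> (real^'n \<Rightarrow> ereal) \<Rightarrow> (nat \<Rightarrow> real^'n \<Rightarrow> real^'m) \<Rightarrow> real \<Rightarrow>
   real^'n \<Rightarrow> (nat \<Rightarrow> nat list \<times> nat list) \<Rightarrow> nat \<Rightarrow> real^'n" where
  "svr_inner N f h g M a bs 0 = a"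
| "svr_inner N f h g M a bs (Suc i) =
     (let x = svr_inner N f h g M a bs i;
          u = (if i = 0 then avg_map N g a else svrg_map_est N g (fst (bs i)) a x);
          J = (if i = 0 then jac (avg_map N g) a else svrg_jac_est N g (snd (bs i)) a x)
      in prox_linear f h M u J x)"

text \<open>
  A realization \<open>\<omega>\<close> of the sampling maps \<open>(k, i)\<close> to the two batches of iteration \<open>i\<close> in epoch
  \<open>k\<close>. \<open>svr_anchor \<dots> k\<close> is the point reached after \<open>k\<close> complete epochs of length \<open>\<tau>\<close>, that is, the
  first iterate of epoch \<open>k + 1\<close>; epochs are numbered from 1.
\<close>

primrec svr_anchor ::
  "nat \<Rightarrow> (real^'m \<Rightarrow> ereal) \<Rightarrow> (real^'n \<Rightarrow> ereal) \<Rightarrow> (nat \<Rightarrow> real^'n \<Rightarrow> real^'m) \<Rightarrow> real \<Rightarrow>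
   nat \<Rightarrow> real^'n \<Rightarrow> (nat \<times> nat \<Rightarrow> nat list \<times> nat list) \<Rightarrow> nat \<Rightarrow> real^'n" where
  "svr_anchor N f h g M \<tau> x0 \<omega> 0 = x0"
| "svr_anchor N f h g M \<tau> x0 \<omega> (Suc k) =
     svr_inner N f h g M (svr_anchor N f h g M \<tau> x0 \<omega> k) (\<lambda>i. \<omega> (Suc k, i)) \<tau>"

definition svr_iterate ::
  "nat \<Rightarrow> (real^'m \<Rightarrow> ereal) \<Rightarrow> (real^'n \<Rightarrow> ereal) \<Rightarrow> (nat \<Rightarrow> real^'n \<Rightarrow> real^'m) \<Rightarrow> real \<Rightarrow>
   nat \<Rightarrow> real^'n \<Rightarrow> (nat \<times> nat \<Rightarrow> nat list \<times> nat list) \<Rightarrow> nat \<Rightarrow> nat \<Rightarrow> real^'n" where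
  "svr_iterate N f h g M \<tau> x0 \<omega> k i =
     svr_inner N f h g M (svr_anchor N f h g M \<tau> x0 \<omega> (k - 1)) (\<lambda>i. \<omega> (k, i)) i"

text \<open>
  \<open>D (k, i)\<close> is the joint law of the two batches of iteration \<open>i\<close> in epoch \<open>k\<close>. Each batch on its
  own consists of independent uniform draws from \<open>{1..N}\<close>; the coupling of the two is arbitrary.
\<close>

definition batch_laws ::
  "nat \<Rightarrow> nat \<Rightarrow> nat \<Rightarrow> nat \<Rightarrow> (nat \<times> nat \<Rightarrow> (nat list \<times> nat list) pmf) \<Rightarrow> bool" where
  "batch_laws N \<tau> b s D \<longleftrightarrow>
     (\<forall>k\<ge>1. \<forall>i\<in>{1..<\<tau>}.
        map_pmf fst (D (k, i)) = replicate_pmf b (pmf_of_set {1..N}) \<and>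
        map_pmf snd (D (k, i)) = replicate_pmf s (pmf_of_set {1..N}))"

text \<open>
  Joint law of the sampling and of the output index \<open>(k\<^sup>*, i\<^sup>*)\<close>: the batches are independent
  between iterations, and the uniformly distributed index is independent of them.
\<close>

definition svr_law ::
  "nat \<Rightarrow> nat \<Rightarrow> (nat \<times> nat \<Rightarrow> (nat list \<times> nat list) pmf) \<Rightarrow>
   ((nat \<times> nat \<Rightarrow> nat list \<times> nat list) \<times> nat \<times> nat) pmf" where
  "svr_law K \<tau> D =
     pair_pmf (Pi_pmf ({1..K} \<times> {1..<\<tau>}) ([], []) D) (pmf_of_set ({1..K} \<times> {0..<\<tau>}))"

definition expected_sq_grad_map ::
  "nat \<Rightarrow> (real^'m \<Rightarrow> ereal) \<Rightarrow> (real^'n \<Rightarrow> ereal) \<Rightarrow> (nat \<Rightarrow> real^'n \<Rightarrow> real^'m) \<Rightarrow> real \<Rightarrow>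
   nat \<Rightarrow> nat \<Rightarrow> (nat \<times> nat \<Rightarrow> (nat list \<times> nat list) pmf) \<Rightarrow> real^'n \<Rightarrow> real" where
  "expected_sq_grad_map N f h g M K \<tau> D x0 =
     measure_pmf.expectation (svr_law K \<tau> D)
       (\<lambda>(\<omega>, k, i). (norm (grad_map N f h g M (svr_iterate N f h g M \<tau> x0 \<omega> k i)))\<^sup>2)"

definition svr_tau :: "nat \<Rightarrow> nat" where
  "svr_tau N = nat \<lceil>1 / 2 * real N powr (1 / 5) - 1\<rceil>"

definition svr_map_batch :: "nat \<Rightarrow> nat" where
  "svr_map_batch N = nat \<lceil>4 * real N powr (4 / 5)\<rceil>"

definition svr_jac_batch :: "nat \<Rightarrow> nat" where
  "svr_jac_batch N = nat \<lceil>real N powr (2 / 5)\<rceil>"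

text \<open>
  Evaluations of the component maps and of their Jacobians in \<open>K\<close> epochs. Iteration 0 takes a full
  pass; in the later iterations every occurrence of a component map or Jacobian in
  \<^const>\<open>svrg_map_est\<close> and \<^const>\<open>svrg_jac_est\<close> is counted, including those at the first iterate
  of the epoch. Reusing the values of the full pass would only lower the counts.
\<close>

definition svr_map_evals :: "nat \<Rightarrow> nat \<Rightarrow> nat" where
  "svr_map_evals N K = (\<Sum>k = 1..K. N + (\<Sum>i = 1..<svr_tau N. 2 * svr_map_batch N))"

definition svr_jac_evals :: "nat \<Rightarrow> nat \<Rightarrow> nat" where
  "svr_jac_evals N K =
     (\<Sum>k = 1..K. N + (\<Sum>i = 1..<svr_tau N. svr_map_batch N + 2 * svr_jac_batch N))"

text \<open>
  The least \<open>K \<ge> 1\<close> with \<open>15 * \<Delta> / (K * \<tau>) \<le> \<epsilon>\<close>, where \<open>\<Delta>\<close> bounds \<open>M\<close> times the initial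
  optimality gap.
\<close>

definition svr_epochs :: "nat \<Rightarrow> real \<Rightarrow> real \<Rightarrow> nat" where
  "svr_epochs N \<Delta> \<epsilon> = max 1 (nat \<lceil>15 * \<Delta> / (real (svr_tau N) * \<epsilon>)\<rceil>)"

end

theory Submission
  imports Defs
begin

text \<open>
  In the spectral norm, averaging independent matrices reduces the variance only up to a factor that
  grows with the dimension. The decrease of the objective at a random iterate involves the error of
  the Jacobian estimate on a random direction, so the objective is not a suitable potential. Instead
  we follow \<open>V x\<close>, the optimal value of the exact prox-linear subproblem at \<open>x\<close>: testing this
  subproblem at the new iterate \<open>y\<close> with the exact prox-linear point \<open>z\<close> of \<open>x\<close> gives
  \<open>V y \<le> V x - 3/8 M \<parallel>z - x\<parallel>\<^sup>2 + 5/8 M \<parallel>y - z\<parallel>\<^sup>2\<close>. A dual solution \<open>p\<close> of the exact subproblem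
  bounds \<open>\<parallel>y - z\<parallel>\<^sup>2\<close> by the error of the map estimate, the error of the Jacobian estimate on the
  fixed direction \<open>z - x\<close>, and that of its transpose on the fixed vector \<open>p\<close>. These are errors of
  vectors, for which averaging does reduce the variance. With the given batch sizes they only cost
  small multiples of \<open>M \<rho>\<^sup>2\<close> and of squared step lengths, where \<open>\<rho> = \<parallel>x - a\<parallel> / N\<^bsup>1/5\<^esup>\<close> and \<open>a\<close> is
  the first iterate of the epoch; over an epoch of length at most \<open>N\<^bsup>1/5\<^esup>/2\<close> the sum of the \<open>\<rho>\<^sup>2\<close> is
  at most an eighth of the sum of the squared step lengths.
\<close>

section \<open>Expectations over finitely supported distributions\<close>

text \<open>All laws used below have finite support, so every function is integrable and
  expectations can be iterated freely.\<close>

lemma expectation_bind_finite: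
  fixes h :: "'b \<Rightarrow> 'c::{banach, second_countable_topology}"
  assumes "finite (set_pmf p)" "\<And>x. x \<in> set_pmf p \<Longrightarrow> finite (set_pmf (q x))"
  shows "measure_pmf.expectation (bind_pmf p q) h =
    measure_pmf.expectation p (\<lambda>x. measure_pmf.expectation (q x) h)"
  by (subst pmf_expectation_bind[of "set_pmf p"])
    (use assms in \<open>auto simp: integral_measure_pmf[of "set_pmf p"]\<close>)

lemma expectation_pair_finite:
  fixes h :: "'a \<times> 'b \<Rightarrow> 'c::{banach, second_countable_topology}"
  assumes "finite (set_pmf p)" "finite (set_pmf q)"
  shows "measure_pmf.expectation (pair_pmf p q) h =
    measure_pmf.expectation p (\<lambda>x. measure_pmf.expectation q (\<lambda>y. h (x, y)))"
  unfolding pair_pmf_def using assms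
  by (subst expectation_bind_finite) (auto simp: expectation_bind_finite)

lemma expectation_mono_finite:
  fixes u v :: "'a \<Rightarrow> real"
  assumes "finite (set_pmf p)" "\<And>x. x \<in> set_pmf p \<Longrightarrow> u x \<le> v x"
  shows "measure_pmf.expectation p u \<le> measure_pmf.expectation p v"
  using assms
  by (intro integral_mono_AE) (auto intro: integrable_measure_pmf_finite simp: AE_measure_pmf_iff)

text \<open>Coordinate \<open>c\<close> is independent of the rest, so a fresh copy of it leaves the
  law unchanged. The inner expectation on the right is the conditional expectation given the other
  coordinates; it replaces conditioning on the past.\<close>

lemma expectation_Pi_pmf_resample:
  fixes \<phi> :: "('i \<Rightarrow> 'b) \<Rightarrow> 'c::{banach, second_countable_topology}"
  assumes "finite A" "c \<in> A" "\<And>i. i \<in> A \<Longrightarrow> finite (set_pmf (D i))"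
  shows "measure_pmf.expectation (Pi_pmf A d D) \<phi> =
    measure_pmf.expectation (Pi_pmf A d D) (\<lambda>\<omega>. measure_pmf.expectation (D c) (\<lambda>b. \<phi> (fun_upd \<omega> c b)))"
proof -
  define Q where "Q = Pi_pmf (A - {c}) d D"
  have A: "A = insert c (A - {c})"
    using assms by auto
  have P: "Pi_pmf A d D = map_pmf (\<lambda>(y, f). fun_upd f c y) (pair_pmf (D c) Q)"
    unfolding Q_def by (subst A, subst Pi_pmf_insert) (use assms in auto)
  have fin: "finite (set_pmf Q)"
    unfolding Q_def using assms by (subst set_Pi_pmf) (auto intro!: finite_PiE_dflt)
  have finD: "finite (set_pmf (D c))"
    using assms by auto
  have "measure_pmf.expectation (Pi_pmf A d D) \<phi> =
      measure_pmf.expectation (map_pmf (\<lambda>(x, y). (y, x)) (pair_pmf Q (D c)))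
        (\<lambda>(y, f). \<phi> (fun_upd f c y))"
    unfolding P by (subst pair_commute_pmf) (simp add: case_prod_unfold)
  also have "\<dots> = measure_pmf.expectation Q (\<lambda>f. measure_pmf.expectation (D c) (\<lambda>b. \<phi> (fun_upd f c b)))"
    using fin finD by (simp add: expectation_pair_finite case_prod_unfold)
  also have "\<dots> = measure_pmf.expectation (Pi_pmf A d D)
      (\<lambda>\<omega>. measure_pmf.expectation (D c) (\<lambda>b. \<phi> (fun_upd \<omega> c b)))"
    unfolding P using fin finD by (simp add: expectation_pair_finite case_prod_unfold)
  finally show ?thesis .
qed

text \<open>The variance is nonnegative. This turns second-moment bounds into first-moment
  bounds.\<close>

lemma expectation_le_of_sq:
  fixes X :: "'a \<Rightarrow> real"
  assumes "finite (set_pmf p)" "measure_pmf.expectation p (\<lambda>x. (X x)\<^sup>2) \<le> c\<^sup>2" "0 \<le> c"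
  shows "measure_pmf.expectation p X \<le> c"
proof -
  let ?m = "measure_pmf.expectation p X"
  note [simp] = integrable_measure_pmf_finite[OF assms(1)]
  have "0 \<le> measure_pmf.expectation p (\<lambda>x. (X x - ?m)\<^sup>2)"
    by simp
  also have "\<dots> = measure_pmf.expectation p (\<lambda>x. (X x)\<^sup>2) - ?m\<^sup>2"
    by (simp add: power2_diff) (simp add: power2_eq_square)
  finally have "?m\<^sup>2 \<le> c\<^sup>2"
    using assms by simp
  then show ?thesis
    using assms(3) by (rule power2_le_imp_le)
qed

lemma finite_set_replicate_pmf: "finite (set_pmf p) \<Longrightarrow> finite (set_pmf (replicate_pmf n p))"
  by (simp add: set_replicate_pmf lists_eq_set finite_lists_length_eq)

text \<open>Induction on the number of draws: the first draw has mean zero and is independent of the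
  others, so the cross term of the expanded square vanishes.\<close>

lemma expectation_sq_norm_sum_replicate:
  fixes Y :: "'a \<Rightarrow> 'b::euclidean_space"
  assumes fin: "finite (set_pmf p)" and zero: "measure_pmf.expectation p Y = 0"
  shows "measure_pmf.expectation (replicate_pmf n p) (\<lambda>xs. (norm (\<Sum>x\<leftarrow>xs. Y x))\<^sup>2) =
    real n * measure_pmf.expectation p (\<lambda>x. (norm (Y x))\<^sup>2)"
proof (induction n)
  case (Suc n)
  let ?R = "replicate_pmf n p"
  note finR = finite_set_replicate_pmf[OF fin]
  note [simp] = integrable_measure_pmf_finite[OF fin] integrable_measure_pmf_finite[OF finR]
  have "measure_pmf.expectation (replicate_pmf (Suc n) p) (\<lambda>xs. (norm (\<Sum>x\<leftarrow>xs. Y x))\<^sup>2) =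
      measure_pmf.expectation p (\<lambda>x. measure_pmf.expectation ?R
        (\<lambda>xs. (norm (Y x))\<^sup>2 + 2 * (Y x \<bullet> (\<Sum>x\<leftarrow>xs. Y x)) + (norm (\<Sum>x\<leftarrow>xs. Y x))\<^sup>2))"
    using fin finR
    by (simp add: expectation_bind_finite power2_norm_eq_inner inner_add_left inner_add_right
        inner_commute algebra_simps del: sum_list.Cons list.map)
      (simp add: inner_add_left inner_add_right inner_commute algebra_simps)
  also have "\<dots> = measure_pmf.expectation p (\<lambda>x. (norm (Y x))\<^sup>2)
      + 2 * measure_pmf.expectation p
          (\<lambda>x. Y x \<bullet> measure_pmf.expectation ?R (\<lambda>xs. \<Sum>x\<leftarrow>xs. Y x))
      + measure_pmf.expectation ?R (\<lambda>xs. (norm (\<Sum>x\<leftarrow>xs. Y x))\<^sup>2)"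
    by simp
  also have "measure_pmf.expectation p
      (\<lambda>x. Y x \<bullet> measure_pmf.expectation ?R (\<lambda>xs. \<Sum>x\<leftarrow>xs. Y x)) = 0"
    by (subst integral_inner_left) (auto simp: zero)
  finally show ?case
    by (simp add: Suc algebra_simps)
qed simp

text \<open>A mean of \<open>b\<close> independent draws has \<open>1/b\<close> of the variance of
  one draw, and that variance is at most the second moment.\<close>

lemma expectation_sq_norm_batch_mean:
  fixes X :: "nat \<Rightarrow> 'b::euclidean_space"
  assumes "N \<ge> 1" "b \<ge> 1"
  shows "measure_pmf.expectation (replicate_pmf b (pmf_of_set {1..N}))
      (\<lambda>B. (norm ((1 / real (length B)) *\<^sub>R (\<Sum>j\<leftarrow>B. X j) - (1 / real N) *\<^sub>R (\<Sum>j = 1..N. X j)))\<^sup>2)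
    \<le> (1 / real b) * ((1 / real N) * (\<Sum>j = 1..N. (norm (X j))\<^sup>2))"
    (is "?lhs \<le> _")
proof -
  let ?p = "pmf_of_set {1..N}"
  define \<mu> where "\<mu> = (1 / real N) *\<^sub>R (\<Sum>j = 1..N. X j)"
  define Y where "Y j = X j - \<mu>" for j
  have ne: "{1..N} \<noteq> {}" "finite {1..N}"
    using assms by auto
  then have fin: "finite (set_pmf ?p)"
    by simp
  note finR = finite_set_replicate_pmf[OF fin]
  note [simp] = integrable_measure_pmf_finite[OF fin] integrable_measure_pmf_finite[OF finR]
  have EX: "measure_pmf.expectation ?p X = \<mu>"
    using ne by (subst integral_measure_pmf[of "{1..N}"])
      (auto simp: \<mu>_def scaleR_sum_right indicator_def)
  have EX2: "measure_pmf.expectation ?p (\<lambda>j. (norm (X j))\<^sup>2) = (1 / real N) * (\<Sum>j = 1..N. (norm (X j))\<^sup>2)"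
    using ne by (subst integral_pmf_of_set) auto
  have EY: "measure_pmf.expectation ?p Y = 0"
    unfolding Y_def using EX by (simp del: One_nat_def)
  have "measure_pmf.expectation ?p (\<lambda>j. (norm (Y j))\<^sup>2) =
      measure_pmf.expectation ?p (\<lambda>j. (norm (X j))\<^sup>2 - 2 * (X j \<bullet> \<mu>) + (norm \<mu>)\<^sup>2)"
    unfolding Y_def
    by (simp add: power2_norm_eq_inner inner_diff_left inner_diff_right inner_commute algebra_simps)
  also have "\<dots> = measure_pmf.expectation ?p (\<lambda>j. (norm (X j))\<^sup>2) - (norm \<mu>)\<^sup>2"
    by (simp add: EX power2_norm_eq_inner del: One_nat_def)
  finally have EY2: "measure_pmf.expectation ?p (\<lambda>j. (norm (Y j))\<^sup>2)
      \<le> (1 / real N) * (\<Sum>j = 1..N. (norm (X j))\<^sup>2)"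
    unfolding EX2 by simp
  have sumY: "(\<Sum>j\<leftarrow>B. Y j) = (\<Sum>j\<leftarrow>B. X j) - real (length B) *\<^sub>R \<mu>" for B
    by (induction B) (auto simp: Y_def algebra_simps)
  have eq: "(norm ((1 / real (length B)) *\<^sub>R (\<Sum>j\<leftarrow>B. X j) - \<mu>))\<^sup>2 =
      (1 / (real b)\<^sup>2) * (norm (\<Sum>j\<leftarrow>B. Y j))\<^sup>2"
    if "B \<in> set_pmf (replicate_pmf b ?p)" for B
  proof -
    have len: "length B = b"
      using that by (simp add: set_replicate_pmf)
    have "(1 / real (length B)) *\<^sub>R (\<Sum>j\<leftarrow>B. X j) - \<mu> = (1 / real b) *\<^sub>R (\<Sum>j\<leftarrow>B. Y j)"
      unfolding sumY len using assms by (simp add: algebra_simps)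
    then show ?thesis
      by (simp add: power_mult_distrib power_divide)
  qed
  have "?lhs = measure_pmf.expectation (replicate_pmf b ?p)
      (\<lambda>B. (1 / (real b)\<^sup>2) * (norm (\<Sum>j\<leftarrow>B. Y j))\<^sup>2)"
    unfolding \<mu>_def[symmetric] by (intro integral_cong_AE) (auto simp: AE_measure_pmf_iff eq)
  also have "\<dots> = (1 / (real b)\<^sup>2) * (real b * measure_pmf.expectation ?p (\<lambda>j. (norm (Y j))\<^sup>2))"
    by (simp only: integral_mult_right_zero expectation_sq_norm_sum_replicate[OF fin EY])
  also have "\<dots> = (1 / real b) * measure_pmf.expectation ?p (\<lambda>j. (norm (Y j))\<^sup>2)"
    using assms(2) by (simp only: power2_eq_square) simp
  also have "\<dots> \<le> (1 / real b) * ((1 / real N) * (\<Sum>j = 1..N. (norm (X j))\<^sup>2))"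
    using EY2 by (intro mult_left_mono) auto
  finally show ?thesis .
qed

section \<open>Strong convexity and subgradients\<close>

text \<open>Cancel \<open>a\<close>, divide by \<open>t\<close> and let \<open>t\<close> tend to 0.
  For a minimum \<open>a\<close> of a strongly convex function this is quadratic growth away from
  the minimizer.\<close>

lemma growth_from_strong_convexity:
  fixes a b c :: real
  assumes "\<And>t. 0 < t \<Longrightarrow> t < 1 \<Longrightarrow> a \<le> (1 - t) * a + t * b - t * (1 - t) * c"
  shows "a + c \<le> b"
proof -
  have "a + (1 - t) * c \<le> b" if "0 < t" "t < 1" for t
  proof -
    have "t * (a + (1 - t) * c) \<le> t * b"
      using assms[OF that] by (simp add: algebra_simps)
    then show ?thesis
      using that by simp
  qed
  then have "\<forall>\<^sub>F t in at_right 0. a + (1 - t) * c \<le> b"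
    by (auto simp: eventually_at_right_field intro!: exI[of _ 1])
  moreover have "((\<lambda>t. a + (1 - t) * c) \<longlongrightarrow> a + (1 - 0) * c) (at_right 0)"
    by (intro tendsto_intros)
  ultimately show ?thesis
    using tendsto_upperbound[OF _ _ trivial_limit_at_right_real] by force
qed

lemma sq_norm_convex_combination:
  fixes v w :: "'a::real_inner"
  shows "(norm ((1 - t) *\<^sub>R v + t *\<^sub>R w))\<^sup>2 =
    (1 - t) * (norm v)\<^sup>2 + t * (norm w)\<^sup>2 - t * (1 - t) * (norm (v - w))\<^sup>2"
  unfolding power2_norm_eq_inner
  by (simp add: inner_add_left inner_add_right inner_diff_left inner_diff_right inner_commute
      algebra_simps)

text \<open>Minimizing sequences are Cauchy by the midpoint inequality.\<close>

lemma midpoint_convex_attains_min: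
  fixes \<phi> :: "'a::euclidean_space \<Rightarrow> real"
  assumes "S \<noteq> {}" and "c > 0"
    and below: "\<And>y. y \<in> S \<Longrightarrow> C \<le> \<phi> y"
    and mid: "\<And>y z. y \<in> S \<Longrightarrow> z \<in> S \<Longrightarrow>
      (1/2) *\<^sub>R (y + z) \<in> S \<and> \<phi> ((1/2) *\<^sub>R (y + z)) \<le> (\<phi> y + \<phi> z) / 2 - c * (norm (y - z))\<^sup>2"
    and closed: "\<And>X y r r0. (\<And>n::nat. X n \<in> S) \<Longrightarrow> X \<longlonglongrightarrow> y \<Longrightarrow> (\<And>n. \<phi> (X n) \<le> r n) \<Longrightarrow>
      r \<longlonglongrightarrow> r0 \<Longrightarrow> y \<in> S \<and> \<phi> y \<le> r0"
  shows "\<exists>y\<in>S. \<forall>z\<in>S. \<phi> y \<le> \<phi> z"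
proof -
  define I where "I = Inf (\<phi> ` S)"
  have bdd: "bdd_below (\<phi> ` S)"
    using below by (auto intro!: bdd_belowI)
  have I: "I \<le> \<phi> z" if "z \<in> S" for z
    unfolding I_def using that bdd by (auto intro: cInf_lower)
  have "\<exists>y\<in>S. \<phi> y < I + inverse (real (Suc n))" for n
  proof -
    have "\<exists>v\<in>\<phi> ` S. v < I + inverse (real (Suc n))"
      using assms(1) unfolding I_def by (intro cInf_lessD) auto
    then show ?thesis
      by auto
  qed
  then obtain X where X: "\<And>n. X n \<in> S" "\<And>n. \<phi> (X n) < I + inverse (real (Suc n))"
    by metis
  have dist_le: "c * (norm (X m - X n))\<^sup>2 \<le> inverse (real (Suc k))" if "k \<le> m" "k \<le> n" for k m n
  proof -
    \<comment> \<open>The midpoint lies in \<open>S\<close>, so its value is at least the infimum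
      \<open>I\<close>.\<close>
    have "I \<le> (\<phi> (X m) + \<phi> (X n)) / 2 - c * (norm (X m - X n))\<^sup>2"
      using mid[OF X(1) X(1), of m n] I by (meson order_trans)
    moreover have "inverse (real (Suc m)) \<le> inverse (real (Suc k))"
      "inverse (real (Suc n)) \<le> inverse (real (Suc k))"
      using that by (auto intro!: le_imp_inverse_le)
    ultimately show ?thesis
      using X(2)[of m] X(2)[of n] by argo
  qed
  have "Cauchy X"
  proof (rule metric_CauchyI)
    fix e :: real assume "e > 0"
    then obtain k where k: "inverse (real (Suc k)) < c * e\<^sup>2"
      using reals_Archimedean[of "c * e\<^sup>2"] \<open>c > 0\<close> by auto
    show "\<exists>M. \<forall>m\<ge>M. \<forall>n\<ge>M. dist (X m) (X n) < e"
    proof (intro exI allI impI)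
      fix m n assume "k \<le> m" "k \<le> n"
      then have "c * (norm (X m - X n))\<^sup>2 < c * e\<^sup>2"
        using dist_le k by (meson le_less_trans)
      then have "(norm (X m - X n))\<^sup>2 < e\<^sup>2"
        using \<open>c > 0\<close> by simp
      then show "dist (X m) (X n) < e"
        using \<open>e > 0\<close> by (auto simp: dist_norm intro: power_less_imp_less_base)
    qed
  qed
  then obtain y where "X \<longlonglongrightarrow> y"
    using Cauchy_convergent convergent_def by blast
  moreover have "(\<lambda>n. I + inverse (real (Suc n))) \<longlonglongrightarrow> I + 0"
    by (intro tendsto_intros LIMSEQ_inverse_real_of_nat)
  ultimately have "y \<in> S \<and> \<phi> y \<le> I"
    using closed[of X y "\<lambda>n. I + inverse (real (Suc n))" I] X by (auto simp: less_imp_le)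
  then show ?thesis
    using I by (meson order_trans)
qed

text \<open>
  Separating the strict epigraph of the convex value function \<open>w \<mapsto> inf\<^sub>y q (w, y)\<close> from the point
  below its graph at \<open>w = 0\<close>.
\<close>

lemma value_function_subgradient:
  fixes q :: "'a::euclidean_space \<Rightarrow> 'b::euclidean_space \<Rightarrow> real"
  assumes "S \<noteq> {}"
    and conv: "\<And>v w y z t. y \<in> S \<Longrightarrow> z \<in> S \<Longrightarrow> 0 \<le> t \<Longrightarrow> t \<le> 1 \<Longrightarrow>
      (1 - t) *\<^sub>R y + t *\<^sub>R z \<in> S \<and>
      q ((1 - t) *\<^sub>R v + t *\<^sub>R w) ((1 - t) *\<^sub>R y + t *\<^sub>R z) \<le> (1 - t) * q v y + t * q w z"
    and min: "\<And>y. y \<in> S \<Longrightarrow> m \<le> q 0 y"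
  shows "\<exists>p. \<forall>w. \<forall>y\<in>S. m + p \<bullet> w \<le> q w y"
proof -
  define C where "C = {(w, s). \<exists>y\<in>S. q w y < s}"
  obtain y0 where y0: "y0 \<in> S"
    using assms(1) by auto
  have "convex C"
    unfolding convex_alt
  proof (intro ballI allI impI)
    fix P Q and t :: real
    assume "P \<in> C" "Q \<in> C" "0 \<le> t \<and> t \<le> 1"
    then obtain v s w r y z where PQ: "P = (v, s)" "Q = (w, r)" "y \<in> S" "z \<in> S"
      "q v y < s" "q w z < r" and t: "0 \<le> t" "t \<le> 1"
      by (auto simp: C_def)
    have "(1 - t) * q v y + t * q w z < (1 - t) * s + t * r"
      using PQ(5,6) t convex_bound_lt[of "q v y - s" 0 "q w z - r" "1 - t" t]
      by (simp add: algebra_simps)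
    then show "(1 - t) *\<^sub>R P + t *\<^sub>R Q \<in> C"
      using conv[OF PQ(3,4) t, of v w] unfolding C_def PQ by (auto intro: le_less_trans)
  qed
  moreover have "C \<noteq> {}"
    using y0 by (auto simp: C_def intro!: exI[of _ "0::'a"] exI[of _ "q 0 y0 + 1"] bexI[of _ y0])
  moreover have "C \<inter> {(0, m)} = {}"
    using min by (fastforce simp: C_def)
  ultimately obtain n \<beta> where n: "n \<noteq> 0" "\<And>P. P \<in> C \<Longrightarrow> \<beta> \<le> n \<bullet> P" "n \<bullet> (0, m) \<le> \<beta>"
    using separating_hyperplane_sets[of "{(0, m)}" C] by (auto simp del: inner_Pair)
  obtain a \<alpha> where n_eq: "n = (a, \<alpha>)"
    by (cases n)
  have sep: "\<alpha> * m \<le> a \<bullet> w + \<alpha> * s" if "y \<in> S" "q w y < s" for w y s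
  proof -
    have "(w, s) \<in> C"
      using that by (auto simp: C_def)
    then show ?thesis
      using n(2)[of "(w, s)"] n(3) by (simp add: n_eq)
  qed
  \<comment> \<open>Above \<open>w = 0\<close> the set \<open>C\<close> contains arbitrarily high
    points.\<close>
  have "\<alpha> \<ge> 0"
  proof (rule ccontr)
    assume "\<not> \<alpha> \<ge> 0"
    define s where "s = max (q 0 y0) m + 1"
    have "\<alpha> * m \<le> \<alpha> * s"
      using sep[OF y0, of 0 s] by (simp add: s_def)
    then show False
      using \<open>\<not> \<alpha> \<ge> 0\<close> by (simp add: s_def max_def split: if_splits)
  qed
  \<comment> \<open>A vertical hyperplane is excluded because \<open>C\<close> has points above
    every \<open>w\<close>, in particular above \<open>w = - a\<close>.\<close>
  moreover have "\<alpha> \<noteq> 0"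
  proof
    assume "\<alpha> = 0"
    then have "a \<noteq> 0"
      using n(1) n_eq by (auto simp: zero_prod_def)
    then have "0 < a \<bullet> a"
      by simp
    moreover have "a \<bullet> a \<le> 0"
      using sep[OF y0, of "- a" "q (- a) y0 + 1"] \<open>\<alpha> = 0\<close> by simp
    ultimately show False
      by linarith
  qed
  ultimately have "\<alpha> > 0"
    by simp
  have "m + (- (1 / \<alpha>) *\<^sub>R a) \<bullet> w \<le> q w y" if "y \<in> S" for w y
  proof (rule field_le_epsilon)
    \<comment> \<open>The slack \<open>e\<close> is there because \<open>C\<close> is the strict
      epigraph.\<close>
    fix e :: real assume "e > 0"
    then have "\<alpha> * m - a \<bullet> w \<le> \<alpha> * (q w y + e)"
      using sep[OF that, of w "q w y + e"] by simp
    then have "(\<alpha> * m - a \<bullet> w) / \<alpha> \<le> q w y + e"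
      using \<open>\<alpha> > 0\<close> by (simp add: pos_divide_le_eq mult.commute)
    then show "m + (- (1 / \<alpha>) *\<^sub>R a) \<bullet> w \<le> q w y + e"
      using \<open>\<alpha> > 0\<close> by (simp add: diff_divide_distrib)
  qed
  then show ?thesis
    by blast
qed

text \<open>Test the subgradient inequality in the direction \<open>p\<close> itself.\<close>

lemma norm_subgradient_le:
  fixes \<phi> :: "'a::real_inner \<Rightarrow> real"
  assumes "\<And>v w. \<bar>\<phi> v - \<phi> w\<bar> \<le> L * norm (v - w)" "\<And>w. \<phi> u + p \<bullet> w \<le> \<phi> (u + w)" "L \<ge> 0"
  shows "norm p \<le> L"
proof (cases "p = 0")
  case False
  have "(norm p)\<^sup>2 \<le> L * norm p"
    using assms(1)[of "u + p" u] assms(2)[of p] by (simp add: power2_norm_eq_inner)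
  then show ?thesis
    using False by (simp add: power2_eq_square)
qed (use assms in auto)

section \<open>Spectral norm and Jacobians\<close>

lemma norm_matrix_vector_le: "norm (A *v v) \<le> spectral_norm A * norm (v :: real^'n)"
  unfolding spectral_norm_def by (rule onorm) (simp add: matrix_vector_mul_bounded_linear)

lemma spectral_norm_nonneg: "0 \<le> spectral_norm (A :: real^'n^'m)"
  unfolding spectral_norm_def by (rule onorm_pos_le) (simp add: matrix_vector_mul_bounded_linear)

text \<open>The adjoint identity moves \<open>A\<close> to the other side, so the transpose obeys
  the same bound.\<close>

lemma norm_vector_matrix_le: "norm (p v* A) \<le> spectral_norm A * norm (p :: real^'m)"
proof (cases "p v* A = 0")
  case False
  have "(norm (p v* A))\<^sup>2 = p \<bullet> (A *v (p v* A))"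
    by (simp add: power2_norm_eq_inner dot_lmul_matrix)
  also have "\<dots> \<le> norm p * norm (A *v (p v* A))"
    by (rule norm_cauchy_schwarz)
  also have "\<dots> \<le> norm p * (spectral_norm A * norm (p v* A))"
    by (intro mult_left_mono norm_matrix_vector_le) auto
  finally show ?thesis
    using False by (simp add: power2_eq_square mult_ac)
qed (use spectral_norm_nonneg[of A] in auto)

lemma jac_eqI:
  assumes "(g has_derivative (\<lambda>v. A *v v)) (at x)"
  shows "jac g x = A"
proof -
  have "g differentiable (at x)"
    using assms differentiable_def by blast
  then have "(\<lambda>v. jac g x *v v) = (\<lambda>v. A *v v)"
    using assms jacobian_works has_derivative_unique by blast
  then show ?thesis
    by (metis matrix_eq)
qed

text \<open>Mean value inequality along the segment, for the curve with its initial linear part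
  removed. Convexity of \<open>S\<close> keeps the segment where the Jacobian is Lipschitz.\<close>

lemma taylor_remainder_bound:
  fixes G :: "real^'n \<Rightarrow> real^'m"
  assumes diff: "\<And>x. G differentiable (at x)" and "convex S"
    and lip: "\<And>x y. x \<in> S \<Longrightarrow> y \<in> S \<Longrightarrow> spectral_norm (jac G x - jac G y) \<le> L * norm (x - y)"
    and "x \<in> S" "y \<in> S"
  shows "norm (G y - G x - jac G x *v (y - x)) \<le> L / 2 * (norm (y - x))\<^sup>2"
proof -
  define d where "d = y - x"
  define \<psi> where "\<psi> t = G (x + t *\<^sub>R d) - t *\<^sub>R (jac G x *v d)" for t :: real
  \<comment> \<open>The antiderivative of the bound \<open>L * norm d ^ 2 * t\<close> on the speed
    of \<open>\<psi>\<close>; it produces the factor 1/2.\<close>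
  define \<phi> where "\<phi> t = L * (norm d)\<^sup>2 * t\<^sup>2 / 2" for t :: real
  have der: "(G has_derivative (\<lambda>v. jac G z *v v)) (at z)" for z
    using diff jacobian_works by blast
  have der\<psi>: "(\<psi> has_vector_derivative (jac G (x + t *\<^sub>R d) - jac G x) *v d) (at t)" for t
    unfolding \<psi>_def has_vector_derivative_def
    by (rule derivative_eq_intros has_derivative_compose[OF _ der] refl)+
      (auto simp: fun_eq_iff matrix_vector_mult_diff_rdistrib matrix_vector_mult_scaleR
        algebra_simps)
  have der\<phi>: "(\<phi> has_real_derivative L * (norm d)\<^sup>2 * t) (at t)" for t
    unfolding \<phi>_def by (auto intro!: derivative_eq_intros)
  have "norm (\<psi> 1 - \<psi> 0) \<le> \<phi> 1 - \<phi> 0"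
  proof (rule differentiable_bound_general)
    show "continuous_on {0..1} \<psi>"
      using der\<psi> by (meson continuous_at_imp_continuous_on has_vector_derivative_continuous)
    show "continuous_on {0..1} \<phi>"
      using der\<phi> by (meson continuous_at_imp_continuous_on DERIV_isCont)
    fix t :: real assume t: "0 < t" "t < 1"
    show "(\<psi> has_vector_derivative (jac G (x + t *\<^sub>R d) - jac G x) *v d) (at t)"
      by (rule der\<psi>)
    show "(\<phi> has_vector_derivative L * (norm d)\<^sup>2 * t) (at t)"
      using der\<phi> by (simp add: has_real_derivative_iff_has_vector_derivative)
    have "x + t *\<^sub>R d = (1 - t) *\<^sub>R x + t *\<^sub>R y"
      by (simp add: d_def algebra_simps)
    then have "x + t *\<^sub>R d \<in> S"
      using assms t by (simp add: convex_alt)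
    then have "spectral_norm (jac G (x + t *\<^sub>R d) - jac G x) \<le> L * (t * norm d)"
      using lip[of "x + t *\<^sub>R d" x] \<open>x \<in> S\<close> t by simp
    then have "spectral_norm (jac G (x + t *\<^sub>R d) - jac G x) * norm d \<le> L * (t * norm d) * norm d"
      by (intro mult_right_mono) auto
    then show "norm ((jac G (x + t *\<^sub>R d) - jac G x) *v d) \<le> L * (norm d)\<^sup>2 * t"
      using norm_matrix_vector_le[of "jac G (x + t *\<^sub>R d) - jac G x" d]
      by (simp add: power2_eq_square mult_ac)
  qed simp
  then show ?thesis
    by (simp add: \<psi>_def \<phi>_def d_def algebra_simps)
qed

section \<open>The composite problem\<close>

lemma ereal_lsc_le_of_seq:
  fixes h :: "'a::metric_space \<Rightarrow> ereal"
  assumes "ereal_lsc h" "X \<longlonglongrightarrow> y" "\<And>n. h (X n) \<le> ereal (r n)" "r \<longlonglongrightarrow> r0"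
  shows "h y \<le> ereal r0"
proof (rule dense_le)
  fix c assume "c < h y"
  then have "\<forall>\<^sub>F z in at y. c < h z"
    using assms(1) le_Liminf_iff[of "h y" "at y" h] by (auto simp: ereal_lsc_def)
  \<comment> \<open>\<open>ereal_lsc\<close> sees punctured neighbourhoods only, while
    \<open>X\<close> may hit \<open>y\<close>; \<open>c < h y\<close> adds the point itself.\<close>
  then have "\<forall>\<^sub>F z in nhds y. c < h z"
    using \<open>c < h y\<close> by (auto simp: eventually_at_filter elim!: eventually_mono)
  then have "\<forall>\<^sub>F n in sequentially. c < h (X n)"
    using assms(2) by (auto dest: eventually_compose_filterlim)
  then have "\<forall>\<^sub>F n in sequentially. c \<le> ereal (r n)"
    by (rule eventually_mono) (use assms(3) in \<open>meson less_imp_le order_trans\<close>)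
  then show "c \<le> ereal r0"
    using assms(4) by (intro tendsto_lowerbound[of "\<lambda>n. ereal (r n)"]) auto
qed

text \<open>The deterministic setting. The theorem obtains \<open>N_ge_1\<close> from the positive
  epoch length and \<open>edom_nonempty\<close> from the case
  \<open>x0 \<in> edom h\<close>.\<close>

locale composite_problem =
  fixes f :: "real^'m \<Rightarrow> ereal"
    and h :: "real^'n \<Rightarrow> ereal"
    and g :: "nat \<Rightarrow> real^'n \<Rightarrow> real^'m"
    and N :: nat
    and lf M :: real
    and lg Lg :: "nat \<Rightarrow> real"
  assumes f_convex: "ereal_convex f"
    and f_lipschitz: "\<And>u v. \<bar>f u - f v\<bar> \<le> ereal (lf * norm (u - v))"
    and h_proper: "\<And>x. h x \<noteq> -\<infinity>"
    and h_convex: "ereal_convex h"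
    and h_lsc: "ereal_lsc h"
    and g_smooth: "\<And>j x. j \<in> {1..N} \<Longrightarrow> g j differentiable (at x)"
    and g_lipschitz: "\<And>j x y. j \<in> {1..N} \<Longrightarrow> x \<in> edom h \<Longrightarrow> y \<in> edom h \<Longrightarrow>
          norm (g j x - g j y) \<le> lg j * norm (x - y)"
    and jac_lipschitz: "\<And>j x y. j \<in> {1..N} \<Longrightarrow> x \<in> edom h \<Longrightarrow> y \<in> edom h \<Longrightarrow>
          spectral_norm (jac (g j) x - jac (g j) y) \<le> Lg j * norm (x - y)"
    and bounded_below: "optimal_value N f h g > -\<infinity>"
    and M_pos: "M > 0"
    and M_ge: "M \<ge> 4 * lf * sqrt (1 / real N * (\<Sum>j = 1..N. (Lg j)\<^sup>2))"
    and N_ge_1: "N \<ge> 1"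
    and edom_nonempty: "edom h \<noteq> {}"
begin

abbreviation "S \<equiv> edom h"

definition "fr u = real_of_ereal (f u)"
definition "hr x = real_of_ereal (h x)"
definition "\<Phi> x = fr (avg_map N g x) + hr x"
definition "L = sqrt (1 / real N * (\<Sum>j = 1..N. (Lg j)\<^sup>2))"

abbreviation "G \<equiv> avg_map N g"
abbreviation "J \<equiv> jac (avg_map N g)"

text \<open>The objective of the prox-linear subproblem for an inner map with value \<open>u\<close>
  and slope \<open>A\<close> at \<open>x\<close>. It agrees with the extended objective for
  \<open>y \<in> S\<close> only.\<close>

definition "model u A x y = fr (u + A *v (y - x)) + hr y + M / 2 * (norm (y - x))\<^sup>2"

abbreviation "prox \<equiv> prox_linear f h M"
abbreviation "xhat x \<equiv> prox (G x) (J x) x"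

definition "V x = model (G x) (J x) x (xhat x)"

section \<open>Real-valued forms of \<open>f\<close>, \<open>h\<close> and the objective\<close>

text \<open>In \<open>ereal\<close> an infinite value minus itself is \<open>\<infinity>\<close>, so
  the Lipschitz bound at the pair \<open>u, u\<close> forces finiteness.\<close>

lemma f_eq: "f u = ereal (fr u)"
proof -
  have "\<bar>f u\<bar> \<noteq> \<infinity>"
    using f_lipschitz[of u u] by (cases "f u") auto
  then show ?thesis
    by (simp add: fr_def ereal_real)
qed

lemma fr_lipschitz: "\<bar>fr u - fr v\<bar> \<le> lf * norm (u - v)"
  using f_lipschitz[of u v] by (simp add: f_eq)

lemma fr_le: "fr u \<le> fr v + lf * norm (u - v)"
  using fr_lipschitz[of u v] by linarith

lemma lf_nonneg: "lf \<ge> 0"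
proof -
  obtain e :: "real^'m" where "norm e = 1"
    using vector_choose_size[of 1] by auto
  then show ?thesis
    using fr_lipschitz[of e 0] by simp
qed

lemma fr_convex:
  assumes "0 \<le> t" "t \<le> 1"
  shows "fr ((1 - t) *\<^sub>R u + t *\<^sub>R v) \<le> (1 - t) * fr u + t * fr v"
proof (cases "t = 0 \<or> t = 1")
  case False
  then have "f ((1 - t) *\<^sub>R u + t *\<^sub>R v) \<le> ereal (1 - t) * f u + ereal t * f v"
    using f_convex assms unfolding ereal_convex_def by auto
  then show ?thesis
    by (simp add: f_eq)
qed auto

lemma h_eq: "x \<in> S \<Longrightarrow> h x = ereal (hr x)"
  using h_proper[of x] by (auto simp: hr_def edom_def ereal_real)

lemma h_outside: "x \<notin> S \<Longrightarrow> h x = \<infinity>"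
  by (simp add: edom_def)

lemma h_convex_real:
  assumes "x \<in> S" "y \<in> S" "0 \<le> t" "t \<le> 1"
  shows "(1 - t) *\<^sub>R x + t *\<^sub>R y \<in> S \<and> hr ((1 - t) *\<^sub>R x + t *\<^sub>R y) \<le> (1 - t) * hr x + t * hr y"
proof (cases "t = 0 \<or> t = 1")
  case False
  then have "0 < t \<and> t < 1"
    using assms by auto
  then have "h ((1 - t) *\<^sub>R x + t *\<^sub>R y) \<le> ereal (1 - t) * h x + ereal t * h y"
    using h_convex unfolding ereal_convex_def by blast
  then have le: "h ((1 - t) *\<^sub>R x + t *\<^sub>R y) \<le> ereal ((1 - t) * hr x + t * hr y)"
    by (simp add: h_eq[OF assms(1)] h_eq[OF assms(2)])
  then have "(1 - t) *\<^sub>R x + t *\<^sub>R y \<in> S"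
    by (auto simp: edom_def)
  then show ?thesis
    using le by (simp add: h_eq)
qed (use assms in auto)

lemma convex_S: "convex S"
  unfolding convex_alt using h_convex_real by auto

lemma h_closed:
  assumes "\<And>n. X n \<in> S" "X \<longlonglongrightarrow> y" "\<And>n. hr (X n) \<le> r n" "r \<longlonglongrightarrow> r0"
  shows "y \<in> S \<and> hr y \<le> r0"
proof -
  have "h y \<le> ereal r0"
    using assms by (intro ereal_lsc_le_of_seq[OF h_lsc, of X y r]) (auto simp: h_eq)
  then show ?thesis
    using h_outside[of y] h_eq[of y] by (cases "y \<in> S") auto
qed

lemma objective_eq: "x \<in> S \<Longrightarrow> objective N f h g x = ereal (\<Phi> x)"
  by (simp add: objective_def \<Phi>_def f_eq h_eq)

definition "\<Phi>_min = real_of_ereal (optimal_value N f h g)"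

lemma optimal_value_eq: "optimal_value N f h g = ereal \<Phi>_min"
proof -
  obtain x where "x \<in> S"
    using edom_nonempty by auto
  then have "optimal_value N f h g \<le> ereal (\<Phi> x)"
    unfolding optimal_value_def objective_eq[OF \<open>x \<in> S\<close>, symmetric] by (intro INF_lower) auto
  then show ?thesis
    using bounded_below by (cases "optimal_value N f h g") (auto simp: \<Phi>_min_def)
qed

lemma \<Phi>_min_le: "x \<in> S \<Longrightarrow> \<Phi>_min \<le> \<Phi> x"
proof -
  assume "x \<in> S"
  then have "optimal_value N f h g \<le> ereal (\<Phi> x)"
    unfolding optimal_value_def objective_eq[OF \<open>x \<in> S\<close>, symmetric] by (intro INF_lower) auto
  then show ?thesis
    by (simp add: optimal_value_eq)
qed

section \<open>Smoothness of the average map\<close>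

lemma L_nonneg: "L \<ge> 0"
  unfolding L_def by (intro real_sqrt_ge_zero mult_nonneg_nonneg sum_nonneg) auto

lemma L_sq: "L\<^sup>2 = 1 / real N * (\<Sum>j = 1..N. (Lg j)\<^sup>2)"
  unfolding L_def by (intro real_sqrt_pow2 mult_nonneg_nonneg sum_nonneg) auto

lemma lf_L: "lf * L \<le> M / 4"
  using M_ge unfolding L_def by simp

text \<open>Arithmetic against quadratic mean, by Cauchy-Schwarz.\<close>

lemma mean_Lg_le: "1 / real N * (\<Sum>j = 1..N. Lg j) \<le> L"
proof (rule power2_le_imp_le[OF _ L_nonneg])
  have "(\<Sum>j = 1..N. Lg j)\<^sup>2 \<le> (\<Sum>j = 1..N. (Lg j)\<^sup>2) * real N"
    using sum_squared_le_sum_of_squares[of Lg "{1..N}"] by simp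
  then have "(\<Sum>j = 1..N. Lg j)\<^sup>2 / (real N)\<^sup>2 \<le> (\<Sum>j = 1..N. (Lg j)\<^sup>2) * real N / (real N)\<^sup>2"
    by (rule divide_right_mono) simp
  then show "(1 / real N * (\<Sum>j = 1..N. Lg j))\<^sup>2 \<le> L\<^sup>2"
    using N_ge_1 unfolding L_sq by (simp add: power_divide power2_eq_square)
qed

lemma g_has_derivative: "j \<in> {1..N} \<Longrightarrow> (g j has_derivative (\<lambda>v. jac (g j) x *v v)) (at x)"
  using g_smooth jacobian_works by blast

lemma sum_matrix_vector: "(\<Sum>j\<in>I. A j) *v v = (\<Sum>j\<in>I. A j *v (v :: real^'k))"
  by (induction I rule: infinite_finite_induct) (auto simp: matrix_vector_mult_add_rdistrib)

lemma J_eq: "J x = (1 / real N) *\<^sub>R (\<Sum>j = 1..N. jac (g j) x)"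
proof (rule jac_eqI)
  have "((\<lambda>y. (1 / real N) *\<^sub>R (\<Sum>j = 1..N. g j y)) has_derivative
      (\<lambda>v. (1 / real N) *\<^sub>R (\<Sum>j = 1..N. jac (g j) x *v v))) (at x)"
    by (intro has_derivative_scaleR_right has_derivative_sum g_has_derivative)
  then show "(G has_derivative (\<lambda>v. ((1 / real N) *\<^sub>R (\<Sum>j = 1..N. jac (g j) x)) *v v)) (at x)"
    by (simp add: avg_map_def[abs_def] scaleR_matrix_vector_assoc[symmetric] sum_matrix_vector)
qed

lemma J_mult: "J x *v v = (1 / real N) *\<^sub>R (\<Sum>j = 1..N. jac (g j) x *v v)"
  by (simp add: J_eq scaleR_matrix_vector_assoc[symmetric] sum_matrix_vector)

lemma component_remainder:
  assumes "j \<in> {1..N}" "x \<in> S" "y \<in> S"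
  shows "norm (g j y - g j x - jac (g j) x *v (y - x)) \<le> Lg j / 2 * (norm (y - x))\<^sup>2"
  using assms by (intro taylor_remainder_bound[OF g_smooth convex_S jac_lipschitz]) auto

lemma G_remainder:
  assumes "x \<in> S" "y \<in> S"
  shows "norm (G y - G x - J x *v (y - x)) \<le> L / 2 * (norm (y - x))\<^sup>2"
proof -
  have "norm (G y - G x - J x *v (y - x)) =
      1 / real N * norm (\<Sum>j = 1..N. g j y - g j x - jac (g j) x *v (y - x))"
    by (simp add: avg_map_def J_mult sum_subtractf flip: scaleR_diff_right)
  also have "\<dots> \<le> 1 / real N * (\<Sum>j = 1..N. Lg j / 2 * (norm (y - x))\<^sup>2)"
    using assms by (intro mult_left_mono sum_norm_le component_remainder) auto
  also have "\<dots> = 1 / real N * (\<Sum>j = 1..N. Lg j) * ((norm (y - x))\<^sup>2 / 2)"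
    by (simp add: sum_distrib_right[symmetric] sum_divide_distrib[symmetric])
  also have "\<dots> \<le> L * ((norm (y - x))\<^sup>2 / 2)"
    using mean_Lg_le by (intro mult_right_mono) auto
  finally show ?thesis
    by simp
qed

text \<open>The remainder constant \<open>L/2\<close>, the Lipschitz constant of \<open>f\<close>
  and \<open>lf * L \<le> M/4\<close> combine to \<open>M/8\<close>, a quarter of the proximal
  weight \<open>M/2\<close>.\<close>

lemma fr_linearization:
  assumes "x \<in> S" "y \<in> S"
  shows "\<bar>fr (G y) - fr (G x + J x *v (y - x))\<bar> \<le> M / 8 * (norm (y - x))\<^sup>2"
proof -
  have "\<bar>fr (G y) - fr (G x + J x *v (y - x))\<bar> \<le> lf * norm (G y - G x - J x *v (y - x))"
    using fr_lipschitz[of "G y" "G x + J x *v (y - x)"] by (simp add: algebra_simps)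
  also have "\<dots> \<le> lf * (L / 2 * (norm (y - x))\<^sup>2)"
    using assms lf_nonneg by (intro mult_left_mono G_remainder)
  also have "\<dots> = lf * L * ((norm (y - x))\<^sup>2 / 2)"
    by simp
  also have "\<dots> \<le> M / 4 * ((norm (y - x))\<^sup>2 / 2)"
    using lf_L by (intro mult_right_mono) auto
  finally show ?thesis
    by simp
qed

section \<open>Existence and stability of prox-linear points\<close>

text \<open>On \<open>S\<close> the function \<open>h\<close> dominates \<open>\<Phi>_min\<close>
  minus the composition of \<open>f\<close> and the average map, which grows at most linearly. This
  makes the subproblems coercive.\<close>

lemma hr_linear_lower_bound: "\<exists>C B. B \<ge> 0 \<and> (\<forall>y\<in>S. C - B * norm (y - x) \<le> hr y)"
proof -
  obtain z where z: "z \<in> S"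
    using edom_nonempty by auto
  define l where "l = 1 / real N * (\<Sum>j = 1..N. \<bar>lg j\<bar>)"
  have l: "l \<ge> 0"
    unfolding l_def by (intro mult_nonneg_nonneg sum_nonneg) auto
  have "\<Phi>_min - fr (G z) - lf * l * norm (z - x) - lf * l * norm (y - x) \<le> hr y" if "y \<in> S" for y
  proof -
    have "norm (G y - G z) = 1 / real N * norm (\<Sum>j = 1..N. g j y - g j z)"
      by (simp add: avg_map_def sum_subtractf flip: scaleR_diff_right)
    also have "\<dots> \<le> 1 / real N * (\<Sum>j = 1..N. \<bar>lg j\<bar> * norm (y - z))"
    proof (intro mult_left_mono sum_norm_le)
      fix j assume "j \<in> {1..N}"
      then have "norm (g j y - g j z) \<le> lg j * norm (y - z)"
        using that z by (rule g_lipschitz)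
      also have "\<dots> \<le> \<bar>lg j\<bar> * norm (y - z)"
        by (intro mult_right_mono) auto
      finally show "norm (g j y - g j z) \<le> \<bar>lg j\<bar> * norm (y - z)" .
    qed auto
    also have "\<dots> = l * norm (y - z)"
      by (simp add: l_def sum_distrib_right[symmetric])
    also have "\<dots> \<le> l * (norm (y - x) + norm (z - x))"
      using l norm_triangle_ineq4[of "y - x" "z - x"] by (intro mult_left_mono) auto
    finally have "lf * norm (G y - G z) \<le> lf * (l * (norm (y - x) + norm (z - x)))"
      using lf_nonneg by (rule mult_left_mono)
    then have "fr (G y) \<le> fr (G z) + lf * l * norm (z - x) + lf * l * norm (y - x)"
      using fr_le[of "G y" "G z"] by (simp add: algebra_simps)
    then show ?thesis
      using \<Phi>_min_le[OF that] by (simp add: \<Phi>_def)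
  qed
  moreover have "lf * l \<ge> 0"
    using l lf_nonneg by simp
  ultimately show ?thesis
    by blast
qed

text \<open>The arguments \<open>v\<close> and \<open>w\<close> of \<open>fr\<close> are decoupled
  from \<open>y\<close> and \<open>z\<close>, so that one inequality serves both the model and its
  perturbations in \<open>dual_solution\<close>.\<close>

lemma model_convex:
  assumes "y \<in> S" "z \<in> S" "0 \<le> t" "t \<le> 1"
  shows "fr ((1 - t) *\<^sub>R v + t *\<^sub>R w) + hr ((1 - t) *\<^sub>R y + t *\<^sub>R z)
      + M / 2 * (norm ((1 - t) *\<^sub>R y + t *\<^sub>R z - x))\<^sup>2
    \<le> (1 - t) * (fr v + hr y + M / 2 * (norm (y - x))\<^sup>2)
      + t * (fr w + hr z + M / 2 * (norm (z - x))\<^sup>2) - t * (1 - t) * (M / 2 * (norm (y - z))\<^sup>2)"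
proof -
  have "(norm ((1 - t) *\<^sub>R y + t *\<^sub>R z - x))\<^sup>2 =
      (norm ((1 - t) *\<^sub>R (y - x) + t *\<^sub>R (z - x)))\<^sup>2"
    by (simp add: algebra_simps)
  also have "\<dots> = (1 - t) * (norm (y - x))\<^sup>2 + t * (norm (z - x))\<^sup>2 - t * (1 - t) * (norm (y - z))\<^sup>2"
    by (subst sq_norm_convex_combination) simp
  finally have "M / 2 * (norm ((1 - t) *\<^sub>R y + t *\<^sub>R z - x))\<^sup>2 = (1 - t) * (M / 2 * (norm (y - x))\<^sup>2)
      + t * (M / 2 * (norm (z - x))\<^sup>2) - t * (1 - t) * (M / 2 * (norm (y - z))\<^sup>2)"
    by (simp only:) (simp add: algebra_simps add_divide_distrib diff_divide_distrib)
  then show ?thesis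
    using h_convex_real[OF assms] fr_convex[OF assms(3,4), of v w] by (simp add: algebra_simps)
qed

lemma affine_convex_combination:
  "u + A *v ((1 - t) *\<^sub>R y + t *\<^sub>R z - x) =
    (1 - t) *\<^sub>R (u + A *v (y - x)) + t *\<^sub>R (u + A *v (z - (x :: real^'n)))"
proof -
  have "(1 - t) *\<^sub>R y + t *\<^sub>R z - x = (1 - t) *\<^sub>R (y - x) + t *\<^sub>R (z - x)"
    by (simp add: algebra_simps)
  then show ?thesis
    by (simp add: matrix_vector_right_distrib matrix_vector_mult_scaleR algebra_simps)
qed

lemma model_strongly_convex:
  assumes "y \<in> S" "z \<in> S" "0 \<le> t" "t \<le> 1"
  shows "model u A x ((1 - t) *\<^sub>R y + t *\<^sub>R z)
    \<le> (1 - t) * model u A x y + t * model u A x z - t * (1 - t) * (M / 2 * (norm (y - z))\<^sup>2)"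
  unfolding model_def affine_convex_combination by (rule model_convex[OF assms])

text \<open>The quadratic term beats an at most linear decrease of the others; the bound comes from
  completing the square.\<close>

lemma model_bounded_below: "\<exists>C. \<forall>y\<in>S. C \<le> model u A x y"
proof -
  obtain C B where B: "B \<ge> 0" "\<And>y. y \<in> S \<Longrightarrow> C - B * norm (y - x) \<le> hr y"
    using hr_linear_lower_bound by blast
  define K where "K = B + lf * spectral_norm A"
  have "fr u + C - K\<^sup>2 / (2 * M) \<le> model u A x y" if "y \<in> S" for y
  proof -
    have "fr u - lf * (spectral_norm A * norm (y - x)) \<le> fr (u + A *v (y - x))"
      using fr_le[of u "u + A *v (y - x)"] norm_matrix_vector_le[of A "y - x"] lf_nonneg
        mult_left_mono[OF norm_matrix_vector_le[of A "y - x"] lf_nonneg]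
      by simp
    then have "fr u + C - K * norm (y - x) + M / 2 * (norm (y - x))\<^sup>2 \<le> model u A x y"
      using B(2)[OF that] by (simp add: model_def K_def algebra_simps)
    moreover have "0 \<le> M / 2 * (norm (y - x) - K / M)\<^sup>2"
      using M_pos by simp
    moreover have "M / 2 * (norm (y - x) - K / M)\<^sup>2
        = M / 2 * (norm (y - x))\<^sup>2 - K * norm (y - x) + K\<^sup>2 / (2 * M)"
      using M_pos by (simp add: power2_diff field_simps power2_eq_square)
    ultimately show ?thesis
      by linarith
  qed
  then show ?thesis
    by blast
qed

lemma model_attains_min: "\<exists>y\<in>S. \<forall>z\<in>S. model u A x y \<le> model u A x z"
proof -
  obtain C where C: "\<And>y. y \<in> S \<Longrightarrow> C \<le> model u A x y"
    using model_bounded_below by blast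
  define q where "q y = fr (u + A *v (y - x)) + M / 2 * (norm (y - x))\<^sup>2" for y
  have model_q: "model u A x y = q y + hr y" for y
    by (simp add: model_def q_def)
  have cont_fr: "continuous_on UNIV fr"
    using fr_lipschitz lf_nonneg
    by (intro lipschitz_on_continuous_on[of lf] lipschitz_onI) (auto simp: dist_norm)
  have "isCont (\<lambda>y. A *v (y - x)) y" for y
    by (rule bounded_linear.isCont[OF matrix_vector_mul_bounded_linear]) (intro continuous_intros)
  then have "isCont (\<lambda>y. u + A *v (y - x)) y" for y
    by (intro continuous_intros)
  then have "isCont (\<lambda>y. fr (u + A *v (y - x))) y" for y
    by (rule isCont_o2) (simp add: continuous_on_interior[OF cont_fr])
  then have cont: "isCont q y" for y
    unfolding q_def by (intro continuous_intros)
  show ?thesis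
  \<comment> \<open>Strong convexity at \<open>t = 1/2\<close> gives the modulus
    \<open>1/2 * 1/2 * M/2 = M/8\<close>.\<close>
  proof (rule midpoint_convex_attains_min[of S "M / 8" C])
    show "S \<noteq> {}" "M / 8 > 0"
      using edom_nonempty M_pos by auto
    show "C \<le> model u A x y" if "y \<in> S" for y
      using C that by blast
    show "(1/2) *\<^sub>R (y + z) \<in> S \<and> model u A x ((1/2) *\<^sub>R (y + z))
        \<le> (model u A x y + model u A x z) / 2 - M / 8 * (norm (y - z))\<^sup>2"
      if "y \<in> S" "z \<in> S" for y z
      using model_strongly_convex[OF that, of "1/2" u A x] h_convex_real[OF that, of "1/2"]
      by (simp add: scaleR_add_right algebra_simps add_divide_distrib)
    fix X y r r0
    assume X: "\<And>n::nat. X n \<in> S" "X \<longlonglongrightarrow> y" "\<And>n. model u A x (X n) \<le> r n" "r \<longlonglongrightarrow> r0"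
    \<comment> \<open>The part \<open>q\<close> is continuous, so closedness of the model reduces to
      that of \<open>h\<close>.\<close>
    have "(\<lambda>n. q (X n)) \<longlonglongrightarrow> q y"
      using cont X(2) by (rule isCont_tendsto_compose)
    then have "(\<lambda>n. r n - q (X n)) \<longlonglongrightarrow> r0 - q y"
      using X(4) by (intro tendsto_intros)
    then have "y \<in> S \<and> hr y \<le> r0 - q y"
      using X by (intro h_closed[of X y "\<lambda>n. r n - q (X n)"]) (auto simp: model_q algebra_simps)
    then show "y \<in> S \<and> model u A x y \<le> r0"
      by (simp add: model_q)
  qed
qed

text \<open>\<open>prox_linear\<close> is a choice among minimizers, so existence comes first. A
  minimizer of \<open>model\<close> over \<open>S\<close> supplies it, since \<open>h\<close> is
  infinite elsewhere.\<close>

lemma prox_is_min: "prox u A x \<in> S \<and> (\<forall>z\<in>S. model u A x (prox u A x) \<le> model u A x z)"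
proof -
  let ?E = "\<lambda>y. f (u + A *v (y - x)) + h y + ereal (M / 2 * (norm (y - x))\<^sup>2)"
  have E: "?E y = ereal (model u A x y)" if "y \<in> S" for y
    using that by (simp add: model_def f_eq h_eq)
  obtain y where y: "y \<in> S" "\<And>z. z \<in> S \<Longrightarrow> model u A x y \<le> model u A x z"
    using model_attains_min by blast
  have "?E y \<le> ?E z" for z
  proof (cases "z \<in> S")
    case True
    then show ?thesis
      unfolding E[OF y(1)] E[OF True] using y(2) by simp
  qed (simp add: f_eq h_outside)
  then have "is_arg_min ?E (\<lambda>_. True) y"
    by (auto simp: is_arg_min_def not_less)
  then have "is_arg_min ?E (\<lambda>_. True) (prox u A x)"
    unfolding prox_linear_def arg_min_def by (rule someI)
  then have min: "?E (prox u A x) \<le> ?E z" for z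
    by (auto simp: is_arg_min_def not_less)
  have S: "prox u A x \<in> S"
  proof (rule ccontr)
    assume "prox u A x \<notin> S"
    then show False
      using min[of y] unfolding E[OF y(1)] by (simp add: h_outside f_eq)
  qed
  have "model u A x (prox u A x) \<le> model u A x z" if "z \<in> S" for z
    using min[of z] unfolding E[OF S] E[OF that] by simp
  with S show ?thesis
    by blast
qed

lemma prox_in_S [simp]: "prox u A x \<in> S"
  using prox_is_min by blast

lemma prox_growth:
  assumes "y \<in> S"
  shows "model u A x (prox u A x) + M / 2 * (norm (prox u A x - y))\<^sup>2 \<le> model u A x y"
proof (rule growth_from_strong_convexity)
  fix t :: real assume t: "0 < t" "t < 1"
  have "model u A x (prox u A x) \<le> model u A x ((1 - t) *\<^sub>R prox u A x + t *\<^sub>R y)"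
    using prox_is_min h_convex_real[OF prox_in_S assms] t by auto
  then show "model u A x (prox u A x) \<le> (1 - t) * model u A x (prox u A x) + t * model u A x y
      - t * (1 - t) * (M / 2 * (norm (prox u A x - y))\<^sup>2)"
    using model_strongly_convex[OF prox_in_S assms, of t u A x u A x] t by linarith
qed

text \<open>A dual solution of the exact subproblem: it linearizes \<open>f\<close> without losing the strong convexity.\<close>

lemma dual_solution:
  fixes x :: "real^'n" and u :: "real^'m" and A :: "real^'n^'m"
  defines "z \<equiv> prox u A x"
  shows "\<exists>p. norm p \<le> lf \<and> (\<forall>v. \<forall>y\<in>S.
    model u A x z + M / 2 * (norm (z - y))\<^sup>2 + p \<bullet> (v - u - A *v (y - x))
      \<le> fr v + hr y + M / 2 * (norm (y - x))\<^sup>2)"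
proof -
  \<comment> \<open>\<open>q w\<close> shifts the argument of \<open>fr\<close> by \<open>w\<close>;
    a subgradient at \<open>w = 0\<close> of its value function is the dual solution.\<close>
  define q where "q w y = model (u + w) A x y" for w y
  have z: "z \<in> S"
    by (simp add: z_def)
  have "\<exists>p. \<forall>w. \<forall>y\<in>S. model u A x z + p \<bullet> w \<le> q w y"
  proof (rule value_function_subgradient)
    fix v w y z t
    assume yz: "y \<in> S" "z \<in> S" and t: "0 \<le> (t::real)" "t \<le> 1"
    have eq: "u + ((1 - t) *\<^sub>R v + t *\<^sub>R w) + A *v ((1 - t) *\<^sub>R y + t *\<^sub>R z - x) =
        (1 - t) *\<^sub>R (u + v + A *v (y - x)) + t *\<^sub>R (u + w + A *v (z - x))"
      using affine_convex_combination[of u A t y z x] by (simp add: algebra_simps)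
    have "0 \<le> t * (1 - t) * (M / 2 * (norm (y - z))\<^sup>2)"
      using t M_pos by simp
    then show "(1 - t) *\<^sub>R y + t *\<^sub>R z \<in> S \<and>
        q ((1 - t) *\<^sub>R v + t *\<^sub>R w) ((1 - t) *\<^sub>R y + t *\<^sub>R z) \<le> (1 - t) * q v y + t * q w z"
      using h_convex_real[OF yz t] model_convex[OF yz t, of "u + v + A *v (y - x)" "u + w + A *v (z - x)" x]
      unfolding q_def model_def eq by linarith
  next
    show "model u A x z \<le> q 0 y" if "y \<in> S" for y
      using prox_is_min that by (simp add: q_def z_def)
  qed (rule edom_nonempty)
  then obtain p where p: "\<And>w y. y \<in> S \<Longrightarrow> model u A x z + p \<bullet> w \<le> q w y"
    by blast
  \<comment> \<open>At \<open>y = z\<close> the inequality makes \<open>p\<close> a subgradient of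
    \<open>fr\<close>.\<close>
  have "norm p \<le> lf"
  proof (rule norm_subgradient_le[of fr lf "u + A *v (z - x)"])
    show "fr (u + A *v (z - x)) + p \<bullet> w \<le> fr (u + A *v (z - x) + w)" for w
      using p[OF z, of w] by (simp add: q_def model_def algebra_simps)
  qed (use fr_lipschitz lf_nonneg in auto)
  moreover have "model u A x z + M / 2 * (norm (z - y))\<^sup>2 + p \<bullet> (v - u - A *v (y - x))
      \<le> fr v + hr y + M / 2 * (norm (y - x))\<^sup>2" if y: "y \<in> S" for v y
  proof -
    define w where "w = v - u - A *v (y - x)"
    have v: "v = u + w + A *v (y - x)"
      by (simp add: w_def)
    \<comment> \<open>Moving \<open>w\<close> and \<open>y\<close> together along the segment from
      \<open>(0, z)\<close> to \<open>(w, y)\<close> recovers the quadratic term, which the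
      separation argument does not give.\<close>
    have "model u A x z + M / 2 * (norm (z - y))\<^sup>2 \<le> q w y - p \<bullet> w"
    proof (rule growth_from_strong_convexity)
      fix t :: real assume t: "0 < t" "t < 1"
      let ?y = "(1 - t) *\<^sub>R z + t *\<^sub>R y"
      have eq: "u + t *\<^sub>R w + A *v (?y - x) =
          (1 - t) *\<^sub>R (u + A *v (z - x)) + t *\<^sub>R (u + w + A *v (y - x))"
        using affine_convex_combination[of u A t z y x] by (simp add: algebra_simps)
      have "model u A x z + t * (p \<bullet> w) \<le> q (t *\<^sub>R w) ?y"
        using p[of ?y "t *\<^sub>R w"] h_convex_real[OF z y] t by simp
      also have "\<dots> \<le> (1 - t) * model u A x z + t * q w y
          - t * (1 - t) * (M / 2 * (norm (z - y))\<^sup>2)"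
        using model_convex[OF z y, of t "u + A *v (z - x)" "u + w + A *v (y - x)" x] t
        unfolding q_def model_def eq by simp
      finally show "model u A x z \<le> (1 - t) * model u A x z + t * (q w y - p \<bullet> w)
          - t * (1 - t) * (M / 2 * (norm (z - y))\<^sup>2)"
        by (simp add: algebra_simps)
    qed
    then show ?thesis
      unfolding q_def model_def v by simp
  qed
  ultimately show ?thesis
    by blast
qed

section \<open>One step of the method\<close>

lemma V_le_\<Phi>:
  assumes "x \<in> S"
  shows "V x \<le> \<Phi> x"
  using prox_is_min[of "G x" "J x" x] assms by (force simp: V_def model_def \<Phi>_def)

text \<open>Passing from the model to \<open>\<Phi>\<close> costs \<open>M/8\<close>, which leaves
  \<open>1/2 - 1/8 = 3/8\<close>.\<close>

lemma \<Phi>_xhat_le: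
  assumes "x \<in> S"
  shows "\<Phi> (xhat x) + 3 / 8 * M * (norm (xhat x - x))\<^sup>2 \<le> V x"
  using abs_le_D1[OF fr_linearization[OF assms prox_in_S, of "G x" "J x" x]]
  unfolding V_def model_def \<Phi>_def by linarith

lemma \<Phi>_min_le_V: "x \<in> S \<Longrightarrow> \<Phi>_min \<le> V x"
proof -
  assume "x \<in> S"
  moreover have "0 \<le> 3 / 8 * M * (norm (xhat x - x))\<^sup>2"
    using M_pos by simp
  ultimately show ?thesis
    using \<Phi>_xhat_le[of x] \<Phi>_min_le[of "xhat x"] by simp
qed

lemma V_step:
  assumes "x \<in> S" "y \<in> S"
  shows "V y \<le> V x - 3 / 8 * M * (norm (xhat x - x))\<^sup>2 + 5 / 8 * M * (norm (y - xhat x))\<^sup>2"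
proof -
  have "V y \<le> model (G y) (J y) y (xhat x)"
    using prox_is_min[of "G y" "J y" y] by (simp add: V_def)
  \<comment> \<open>Here the linearization error at \<open>y\<close> adds to the proximal term:
    \<open>1/2 + 1/8 = 5/8\<close>.\<close>
  also have "\<dots> \<le> \<Phi> (xhat x) + 5 / 8 * M * (norm (y - xhat x))\<^sup>2"
    using abs_le_D2[OF fr_linearization[OF assms(2) prox_in_S, of "G x" "J x" x]]
    unfolding model_def \<Phi>_def norm_minus_commute[of y] by linarith
  finally show ?thesis
    using \<Phi>_xhat_le[OF assms(1)] by simp
qed

text \<open>The choice depends on \<open>x\<close> alone. It is thus fixed before the batches are
  drawn, as the variance bound requires.\<close>

definition "dual x = (SOME p. norm p \<le> lf \<and> (\<forall>v. \<forall>y\<in>S.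
    V x + M / 2 * (norm (xhat x - y))\<^sup>2 + p \<bullet> (v - G x - J x *v (y - x))
      \<le> fr v + hr y + M / 2 * (norm (y - x))\<^sup>2))"

lemma dual:
  "norm (dual x) \<le> lf \<and> (\<forall>v. \<forall>y\<in>S.
    V x + M / 2 * (norm (xhat x - y))\<^sup>2 + dual x \<bullet> (v - G x - J x *v (y - x))
      \<le> fr v + hr y + M / 2 * (norm (y - x))\<^sup>2)"
  using dual_solution[of "G x" "J x" x] unfolding dual_def V_def by (rule someI_ex)

lemmas norm_dual = dual[THEN conjunct1]
lemmas dual_le = dual[THEN conjunct2, rule_format]

text \<open>The estimated model at \<open>y\<close> is bounded above by strong convexity, tested at
  \<open>xhat x\<close>, and below by the dual solution. The Jacobian error then acts on
  \<open>xhat x - x\<close> and, transposed, on \<open>dual x\<close>; the random step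
  \<open>y - x\<close> enters only through its norm.\<close>

lemma prox_error:
  fixes x :: "real^'n" and A :: "real^'n^'m" and u :: "real^'m"
  defines "y \<equiv> prox u A x"
  shows "M * (norm (y - xhat x))\<^sup>2 \<le> 2 * (lf * norm (u - G x)) + lf * norm ((A - J x) *v (xhat x - x))
    + norm (dual x v* (A - J x)) * norm (y - x)"
proof -
  have "model u A x y + M / 2 * (norm (y - xhat x))\<^sup>2 \<le> model u A x (xhat x)"
    unfolding y_def by (rule prox_growth) simp
  also have "model u A x (xhat x) \<le> V x + lf * norm (u - G x + (A - J x) *v (xhat x - x))"
    using fr_le[of "u + A *v (xhat x - x)" "G x + J x *v (xhat x - x)"]
    by (simp add: V_def model_def matrix_vector_mult_diff_rdistrib algebra_simps)
  also have "\<dots> \<le> V x + lf * (norm (u - G x) + norm ((A - J x) *v (xhat x - x)))"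
    by (intro add_left_mono mult_left_mono norm_triangle_ineq lf_nonneg)
  finally have upper: "model u A x y + M / 2 * (norm (y - xhat x))\<^sup>2
      \<le> V x + lf * norm (u - G x) + lf * norm ((A - J x) *v (xhat x - x))"
    by (simp add: algebra_simps)
  have eq: "u + A *v (y - x) - G x - J x *v (y - x) = (u - G x) + (A - J x) *v (y - x)"
    by (simp add: matrix_vector_mult_diff_rdistrib)
  have "y \<in> S"
    by (simp add: y_def)
  then have "V x + M / 2 * (norm (y - xhat x))\<^sup>2 + (dual x \<bullet> (u - G x) + dual x \<bullet> ((A - J x) *v (y - x)))
      \<le> model u A x y"
    using dual_le[where y = y and x = x and v = "u + A *v (y - x)"]
    by (simp only: eq inner_add_right model_def norm_minus_commute[of "xhat x" y])
  moreover have "\<bar>dual x \<bullet> (u - G x)\<bar> \<le> lf * norm (u - G x)"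
    using Cauchy_Schwarz_ineq2[of "dual x" "u - G x"] norm_dual[of x]
    by (meson mult_right_mono norm_ge_zero order_trans)
  moreover have "\<bar>dual x \<bullet> ((A - J x) *v (y - x))\<bar> \<le> norm (dual x v* (A - J x)) * norm (y - x)"
    using Cauchy_Schwarz_ineq2 by (metis dot_lmul_matrix)
  ultimately show ?thesis
    using upper by linarith
qed

end

section \<open>Errors of the estimators\<close>

lemma linear_sum_list: "linear T \<Longrightarrow> T (\<Sum>j\<leftarrow>xs. A j) = (\<Sum>j\<leftarrow>xs. T (A j))"
  by (induction xs) (auto simp: linear_0 linear_add)

lemma nat_ceiling_ge: "r \<le> real (nat \<lceil>r\<rceil>)"
  by linarith

lemma svr_tau_le:
  assumes "svr_tau N \<ge> 1"
  shows "real (svr_tau N) \<le> real N powr (1/5) / 2"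
  using assms unfolding svr_tau_def by linarith

lemma svr_map_batch_ge: "4 * (real N powr (1/5)) ^ 4 \<le> real (svr_map_batch N)"
  using nat_ceiling_ge[of "4 * real N powr (4/5)"]
  by (cases "N = 0") (auto simp: svr_map_batch_def powr_power)

lemma svr_jac_batch_ge: "(real N powr (1/5)) ^ 2 \<le> real (svr_jac_batch N)"
  using nat_ceiling_ge[of "real N powr (2/5)"]
  by (cases "N = 0") (auto simp: svr_jac_batch_def powr_power)

context composite_problem
begin

abbreviation "q \<equiv> real N powr (1/5)"

lemma q_pos: "q > 0"
  using N_ge_1 by simp

lemma svr_batches_pos: "svr_map_batch N \<ge> 1" "svr_jac_batch N \<ge> 1"
proof -
  have "0 < 4 * q ^ 4" "0 < q ^ 2"
    using q_pos by auto
  then have "0 < real (svr_map_batch N)" "0 < real (svr_jac_batch N)"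
    using svr_map_batch_ge[of N] svr_jac_batch_ge[of N] by linarith+
  then show "svr_map_batch N \<ge> 1" "svr_jac_batch N \<ge> 1"
    by auto
qed

text \<open>After the first-order correction each summand is a Taylor remainder, of size at most
  \<open>Lg j / 2 * norm (x - a) ^ 2\<close>. A batch of at least \<open>4 * q ^ 4\<close> reduces
  the root mean square to \<open>L/4 * (norm (x - a) / q) ^ 2\<close>, and
  \<open>lf * L \<le> M/4\<close> gives \<open>M/16\<close>.\<close>

lemma map_error:
  assumes "a \<in> S" "x \<in> S"
  shows "measure_pmf.expectation (replicate_pmf (svr_map_batch N) (pmf_of_set {1..N}))
      (\<lambda>B. lf * norm (svrg_map_est N g B a x - G x)) \<le> M / 16 * (norm (x - a) / q)\<^sup>2"
proof -
  let ?P = "replicate_pmf (svr_map_batch N) (pmf_of_set {1..N})"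
  define X where "X j = g j x - g j a - jac (g j) a *v (x - a)" for j
  define r where "r = norm (x - a)"
  have "(1 / real N) *\<^sub>R (\<Sum>j = 1..N. X j) = G x - G a - J a *v (x - a)"
    by (simp only: X_def avg_map_def J_mult sum_subtractf scaleR_diff_right)
  then have err: "svrg_map_est N g B a x - G x =
      (1 / real (length B)) *\<^sub>R (\<Sum>j\<leftarrow>B. X j) - (1 / real N) *\<^sub>R (\<Sum>j = 1..N. X j)" for B
    by (simp add: svrg_map_est_def X_def)
  have pow: "1 / (4 * Q ^ 4) * (L\<^sup>2 * (r\<^sup>2)\<^sup>2 / 4) = (L * (r / Q)\<^sup>2 / 4)\<^sup>2" for Q :: real
    by (simp add: power_mult_distrib power_divide)
  have sum_eq: "1 / real N * (\<Sum>j = 1..N. (Lg j / 2 * r\<^sup>2)\<^sup>2) = L\<^sup>2 * (r\<^sup>2)\<^sup>2 / 4"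
    unfolding L_sq
    by (simp add: power_mult_distrib power_divide flip: sum_distrib_right sum_divide_distrib)
  have fin: "finite (set_pmf ?P)"
    using N_ge_1 by (intro finite_set_replicate_pmf) auto
  have "measure_pmf.expectation ?P (\<lambda>B. (norm (svrg_map_est N g B a x - G x))\<^sup>2)
      \<le> 1 / real (svr_map_batch N) * (1 / real N * (\<Sum>j = 1..N. (norm (X j))\<^sup>2))"
    unfolding err by (intro expectation_sq_norm_batch_mean N_ge_1 svr_batches_pos)
  also have "\<dots> \<le> 1 / (4 * q ^ 4) * (1 / real N * (\<Sum>j = 1..N. (Lg j / 2 * r\<^sup>2)\<^sup>2))"
    unfolding X_def r_def using svr_map_batch_ge[of N] q_pos svr_batches_pos assms
    by (intro mult_mono mult_left_mono sum_mono power_mono component_remainder divide_left_mono)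
      (auto intro!: divide_nonneg_nonneg sum_nonneg)
  also have "\<dots> = 1 / (4 * q ^ 4) * (L\<^sup>2 * (r\<^sup>2)\<^sup>2 / 4)"
    unfolding sum_eq ..
  also have "\<dots> = (L * (r / q)\<^sup>2 / 4)\<^sup>2"
    by (rule pow)
  finally have "measure_pmf.expectation ?P (\<lambda>B. norm (svrg_map_est N g B a x - G x)) \<le> L * (r / q)\<^sup>2 / 4"
    by (rule expectation_le_of_sq[OF fin]) (simp add: L_nonneg)
  then have "lf * measure_pmf.expectation ?P (\<lambda>B. norm (svrg_map_est N g B a x - G x))
      \<le> lf * (L * (r / q)\<^sup>2 / 4)"
    using lf_nonneg by (rule mult_left_mono)
  also have "\<dots> = lf * L * ((r / q)\<^sup>2 / 4)"
    by simp
  also have "\<dots> \<le> M / 4 * ((r / q)\<^sup>2 / 4)"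
    using lf_L by (rule mult_right_mono) simp
  finally show ?thesis
    by (simp add: r_def)
qed

text \<open>
  The variance bound fails for the spectral norm itself, since that norm is not Euclidean. It holds
  for the image of the error under a fixed linear map into a Euclidean space.
\<close>

lemma jac_error:
  fixes T :: "real^'n^'m \<Rightarrow> 'b::euclidean_space"
  assumes "a \<in> S" "x \<in> S" and T: "linear T" "\<And>A. norm (T A) \<le> spectral_norm A * c" and "c \<ge> 0"
  shows "measure_pmf.expectation (replicate_pmf (svr_jac_batch N) (pmf_of_set {1..N}))
      (\<lambda>B. (norm (T (svrg_jac_est N g B a x - J x)))\<^sup>2) \<le> (L * (norm (x - a) / q) * c)\<^sup>2"
proof -
  let ?P = "replicate_pmf (svr_jac_batch N) (pmf_of_set {1..N})"
  define X where "X j = T (jac (g j) x - jac (g j) a)" for j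
  define r where "r = norm (x - a)"
  have "(1 / real N) *\<^sub>R (\<Sum>j = 1..N. X j) = T (J x - J a)"
    by (simp add: X_def J_eq linear_sum[OF T(1)] linear_scale[OF T(1)] linear_diff[OF T(1)]
        sum_subtractf scaleR_diff_right)
  moreover have "(1 / real (length B)) *\<^sub>R (\<Sum>j\<leftarrow>B. X j) =
      T (svrg_jac_est N g B a x) - T (J a)" for B
    by (simp add: X_def svrg_jac_est_def linear_sum_list[OF T(1)] linear_scale[OF T(1)]
        linear_add[OF T(1)])
  ultimately have err: "T (svrg_jac_est N g B a x - J x) =
      (1 / real (length B)) *\<^sub>R (\<Sum>j\<leftarrow>B. X j) - (1 / real N) *\<^sub>R (\<Sum>j = 1..N. X j)" for B
    by (simp add: linear_diff[OF T(1)])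
  have sum_eq: "1 / real N * (\<Sum>j = 1..N. (Lg j * r * c)\<^sup>2) = L\<^sup>2 * r\<^sup>2 * c\<^sup>2"
    unfolding L_sq by (simp add: power_mult_distrib flip: sum_distrib_right)
  have X_le: "norm (X j) \<le> Lg j * r * c" if "j \<in> {1..N}" for j
    unfolding X_def r_def using that assms T(2)[of "jac (g j) x - jac (g j) a"]
    by (meson jac_lipschitz mult_right_mono order_trans)
  have "measure_pmf.expectation ?P (\<lambda>B. (norm (T (svrg_jac_est N g B a x - J x)))\<^sup>2)
      \<le> 1 / real (svr_jac_batch N) * (1 / real N * (\<Sum>j = 1..N. (norm (X j))\<^sup>2))"
    unfolding err by (intro expectation_sq_norm_batch_mean N_ge_1 svr_batches_pos)
  also have "\<dots> \<le> 1 / q\<^sup>2 * (1 / real N * (\<Sum>j = 1..N. (Lg j * r * c)\<^sup>2))"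
    using svr_jac_batch_ge[of N] q_pos svr_batches_pos
    by (intro mult_mono mult_left_mono sum_mono power_mono X_le divide_left_mono)
      (auto intro!: divide_nonneg_nonneg sum_nonneg)
  also have "\<dots> = 1 / q\<^sup>2 * (L\<^sup>2 * r\<^sup>2 * c\<^sup>2)"
    unfolding sum_eq ..
  also have "\<dots> = (L * (r / q) * c)\<^sup>2"
    by (simp add: power_mult_distrib power_divide)
  finally show ?thesis
    by (simp add: r_def)
qed

text \<open>\<open>jac_error\<close> for the map sending \<open>A\<close> to \<open>A *v v\<close>.
  It is applied with \<open>v = xhat x - x\<close>, which does not depend on the batch.\<close>

lemma jac_direction_error:
  assumes "a \<in> S" "x \<in> S"
  shows "measure_pmf.expectation (replicate_pmf (svr_jac_batch N) (pmf_of_set {1..N}))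
      (\<lambda>B. lf * norm ((svrg_jac_est N g B a x - J x) *v v)) \<le> M / 4 * (norm (x - a) / q) * norm v"
proof -
  let ?P = "replicate_pmf (svr_jac_batch N) (pmf_of_set {1..N})"
  have fin: "finite (set_pmf ?P)"
    using N_ge_1 by (intro finite_set_replicate_pmf) auto
  have "linear (\<lambda>A::real^'n^'m. A *v v)"
    by (intro linearI) (auto simp: matrix_vector_mult_add_rdistrib scaleR_matrix_vector_assoc)
  then have "measure_pmf.expectation ?P (\<lambda>B. (norm ((svrg_jac_est N g B a x - J x) *v v))\<^sup>2)
      \<le> (L * (norm (x - a) / q) * norm v)\<^sup>2"
    using assms by (intro jac_error norm_matrix_vector_le) auto
  then have "measure_pmf.expectation ?P (\<lambda>B. norm ((svrg_jac_est N g B a x - J x) *v v))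
      \<le> L * (norm (x - a) / q) * norm v"
    by (rule expectation_le_of_sq[OF fin]) (simp add: L_nonneg)
  then have "lf * measure_pmf.expectation ?P (\<lambda>B. norm ((svrg_jac_est N g B a x - J x) *v v))
      \<le> lf * (L * (norm (x - a) / q) * norm v)"
    using lf_nonneg by (rule mult_left_mono)
  also have "\<dots> = lf * L * (norm (x - a) / q * norm v)"
    by simp
  also have "\<dots> \<le> M / 4 * (norm (x - a) / q * norm v)"
    using lf_L by (rule mult_right_mono) simp
  finally show ?thesis
    by simp
qed

text \<open>\<open>jac_error\<close> for multiplication from the left by \<open>dual x\<close>,
  whose norm is at most \<open>lf\<close>. The bound stays squared because Young's inequality in
  \<open>V_prox_le\<close> splits this error from the random step length.\<close>

lemma jac_dual_error:
  assumes "a \<in> S" "x \<in> S"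
  shows "measure_pmf.expectation (replicate_pmf (svr_jac_batch N) (pmf_of_set {1..N}))
      (\<lambda>B. (norm (dual x v* (svrg_jac_est N g B a x - J x)))\<^sup>2) \<le> M\<^sup>2 / 16 * (norm (x - a) / q)\<^sup>2"
proof -
  have "linear (\<lambda>A::real^'n^'m. dual x v* A)"
    by (intro linearI) (auto simp: vector_matrix_mult_add_rdistrib vector_scaleR_matrix_ac)
  then have "measure_pmf.expectation (replicate_pmf (svr_jac_batch N) (pmf_of_set {1..N}))
      (\<lambda>B. (norm (dual x v* (svrg_jac_est N g B a x - J x)))\<^sup>2) \<le> (L * (norm (x - a) / q) * norm (dual x))\<^sup>2"
    using assms by (intro jac_error norm_vector_matrix_le) auto
  also have "\<dots> = (L * norm (dual x))\<^sup>2 * (norm (x - a) / q)\<^sup>2"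
    by (simp add: power_mult_distrib power_divide)
  also have "\<dots> \<le> (M / 4)\<^sup>2 * (norm (x - a) / q)\<^sup>2"
    using lf_L norm_dual[of x] L_nonneg mult_left_mono[OF norm_dual[of x] L_nonneg]
    by (intro mult_right_mono power_mono) (auto simp: mult.commute)
  finally show ?thesis
    by (simp add: power_divide)
qed

section \<open>Decrease of \<open>V\<close> in one iteration\<close>

text \<open>
  The weights 37/40 and 3/10 balance \<open>prox_error\<close> against the triangle inequality
  \<open>\<parallel>y - x\<parallel>\<^sup>2 \<le> 5/3 \<parallel>xhat x - x\<parallel>\<^sup>2 + 5/2 \<parallel>y - xhat x\<parallel>\<^sup>2\<close>. The term in \<open>\<parallel>x - a\<parallel>\<^sup>2\<close> carries
  eight times the weight of the squared step length because that is what the sum over an epoch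
  can absorb.
\<close>

lemma V_prox_le:
  fixes x :: "real^'n" and A :: "real^'n^'m" and u :: "real^'m"
  defines "y \<equiv> prox u A x"
  assumes "x \<in> S"
  shows "V y + 77/1000 * M * (norm (y - x))\<^sup>2 \<le> V x - 7/40 * M * (norm (xhat x - x))\<^sup>2
    + 37/40 * (2 * (lf * norm (u - G x)) + lf * norm ((A - J x) *v (xhat x - x))
      + 11/2 * (norm (dual x v* (A - J x)))\<^sup>2 / M)"
proof -
  define d D e W E F where "d = norm (y - x)" and "D = norm (xhat x - x)" and "e = norm (y - xhat x)"
    and "W = norm (dual x v* (A - J x))"
    and "E = 2 * (lf * norm (u - G x)) + lf * norm ((A - J x) *v (xhat x - x))"
    and "F = 11/2 * (norm (dual x v* (A - J x)))\<^sup>2 / M"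
  \<comment> \<open>Young's inequality; the weight 11 leaves only \<open>M * d^2 / 22\<close> to
    absorb.\<close>
  have "0 \<le> (11 * W / M - d)\<^sup>2 * (M / 22)"
    using M_pos by simp
  also have "\<dots> = F - W * d + M * d\<^sup>2 / 22"
    using M_pos by (simp add: F_def W_def[symmetric] power2_diff power2_eq_square field_simps)
  finally have young: "W * d \<le> F + M * d\<^sup>2 / 22"
    by simp
  have err: "M * e\<^sup>2 \<le> E + W * d"
    using prox_error[of u A x] by (simp add: y_def d_def e_def W_def E_def)
  have "d \<le> D + e"
    using norm_triangle_ineq[of "xhat x - x" "y - xhat x"] by (simp add: d_def D_def e_def)
  then have "d\<^sup>2 \<le> (D + e)\<^sup>2"
    by (intro power_mono) (auto simp: d_def)
  also have "\<dots> \<le> 5/3 * D\<^sup>2 + 5/2 * e\<^sup>2"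
    using zero_le_power2[of "2 * D - 3 * e"] by (simp add: power2_eq_square algebra_simps)
  finally have "M * d\<^sup>2 \<le> M * (5/3 * D\<^sup>2 + 5/2 * e\<^sup>2)"
    using M_pos by (intro mult_left_mono) auto
  then have tri: "M * d\<^sup>2 \<le> 5/3 * (M * D\<^sup>2) + 5/2 * (M * e\<^sup>2)"
    by (simp add: algebra_simps)
  have step: "V y \<le> V x - 3/8 * (M * D\<^sup>2) + 5/8 * (M * e\<^sup>2)"
    using V_step[OF assms(2), of y] by (simp add: y_def d_def D_def e_def)
  have "0 \<le> M * d\<^sup>2"
    using M_pos by simp
  \<comment> \<open>Split \<open>5/8 = 37/40 - 3/10\<close> in \<open>step\<close>, using
    \<open>err\<close> on the first part and \<open>tri\<close> on the second. The weight of
    \<open>M * D^2\<close> becomes \<open>3/8 - 1/5 = 7/40\<close>, that of \<open>M * d^2\<close>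
    becomes \<open>3/25 - 37/880\<close>, which exceeds \<open>77/1000\<close>.\<close>
  then have "V y + 77/1000 * (M * d\<^sup>2) \<le> V x - 7/40 * (M * D\<^sup>2) + 37/40 * (E + F)"
    using young err tri step by argo
  then show ?thesis
    by (simp add: d_def D_def E_def F_def)
qed

text \<open>The bound of \<open>V_prox_le\<close> is a sum of terms that each depend on one of the
  two batches. Hence only the marginals of \<open>\<beta>\<close> enter and the coupling is
  free.\<close>

lemma expected_step:
  assumes S: "a \<in> S" "x \<in> S"
    and fst: "map_pmf fst \<beta> = replicate_pmf (svr_map_batch N) (pmf_of_set {1..N})"
    and snd: "map_pmf snd \<beta> = replicate_pmf (svr_jac_batch N) (pmf_of_set {1..N})"
    and fin: "finite (set_pmf \<beta>)"
  defines "y \<equiv> \<lambda>b. prox (svrg_map_est N g (fst b) a x) (svrg_jac_est N g (snd b) a x) x"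
  shows "measure_pmf.expectation \<beta> (\<lambda>b. V (y b) + 77/1000 * M * (norm (y b - x))\<^sup>2)
    \<le> V x - M / 15 * (norm (xhat x - x))\<^sup>2 + 77/125 * M * (norm (x - a) / q)\<^sup>2"
proof -
  define \<rho> where "\<rho> = norm (x - a) / q"
  define D where "D = norm (xhat x - x)"
  define e1 where "e1 B = lf * norm (svrg_map_est N g B a x - G x)" for B
  define e2 where "e2 B = lf * norm ((svrg_jac_est N g B a x - J x) *v (xhat x - x))" for B
  define e3 where "e3 B = (norm (dual x v* (svrg_jac_est N g B a x - J x)))\<^sup>2" for B
  note [simp] = integrable_measure_pmf_finite[OF fin]
  have E1: "measure_pmf.expectation \<beta> (\<lambda>b. e1 (fst b)) \<le> M / 16 * \<rho>\<^sup>2"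
    using map_error[OF S] fst[symmetric] by (simp add: e1_def \<rho>_def)
  have E2: "measure_pmf.expectation \<beta> (\<lambda>b. e2 (snd b)) \<le> M / 4 * \<rho> * D"
    using jac_direction_error[OF S] snd[symmetric] by (simp add: e2_def \<rho>_def D_def)
  have E3: "measure_pmf.expectation \<beta> (\<lambda>b. e3 (snd b)) \<le> M\<^sup>2 / 16 * \<rho>\<^sup>2"
    using jac_dual_error[OF S] snd[symmetric] by (simp add: e3_def \<rho>_def)
  have "measure_pmf.expectation \<beta> (\<lambda>b. V (y b) + 77/1000 * M * (norm (y b - x))\<^sup>2)
      \<le> measure_pmf.expectation \<beta> (\<lambda>b. V x - 7/40 * M * D\<^sup>2
        + 37/40 * (2 * e1 (fst b) + e2 (snd b) + 11/2 * e3 (snd b) / M))"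
    unfolding y_def e1_def e2_def e3_def D_def
    by (intro expectation_mono_finite fin V_prox_le S)
  also have "\<dots> = V x - 7/40 * M * D\<^sup>2 + 37/40 * (2 * measure_pmf.expectation \<beta> (\<lambda>b. e1 (fst b))
      + measure_pmf.expectation \<beta> (\<lambda>b. e2 (snd b))
      + 11/2 / M * measure_pmf.expectation \<beta> (\<lambda>b. e3 (snd b)))"
    by (simp add: algebra_simps)
  also have "\<dots> \<le> V x - 7/40 * M * D\<^sup>2 + 37/40 * (2 * (M / 16 * \<rho>\<^sup>2) + M / 4 * \<rho> * D
      + 11/2 / M * (M\<^sup>2 / 16 * \<rho>\<^sup>2))"
    using E1 E2 E3 M_pos by (intro add_mono mult_left_mono order_refl) auto
  also have "\<dots> = V x - 7/40 * (M * D\<^sup>2) + 37/40 * (15/32 * (M * \<rho>\<^sup>2) + M * (\<rho> * D) / 4)"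
    using M_pos by (simp add: power2_eq_square field_simps)
  also have "\<dots> \<le> V x - M * D\<^sup>2 / 15 + 77/125 * (M * \<rho>\<^sup>2)"
  proof -
    \<comment> \<open>Young's inequality for \<open>\<rho> * D\<close>. It leaves
      \<open>7/40 - 37/480\<close>, more than \<open>1/15\<close>, for \<open>M * D^2\<close>, and
      \<open>37/40 * 21/32\<close>, less than \<open>77/125\<close>, for
      \<open>M * \<rho>^2\<close>.\<close>
    have "0 \<le> M / 48 * (3 * \<rho> - 2 * D)\<^sup>2"
      using M_pos by simp
    then have "M * (\<rho> * D) / 4 \<le> 3/16 * (M * \<rho>\<^sup>2) + M * D\<^sup>2 / 12"
      by (simp add: power2_eq_square algebra_simps)
    moreover have "0 \<le> M * D\<^sup>2" "0 \<le> M * \<rho>\<^sup>2"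
      using M_pos by auto
    ultimately show ?thesis
      by argo
  qed
  finally show ?thesis
    by (simp add: \<rho>_def D_def)
qed

text \<open>Iteration 0 uses exact values, so the new iterate is \<open>xhat x\<close>; the claim
  follows from \<open>77/1000 + 1/15 \<le> 3/8\<close>.\<close>

lemma exact_step:
  assumes "x \<in> S"
  shows "V (xhat x) + 77/1000 * M * (norm (xhat x - x))\<^sup>2 \<le> V x - M / 15 * (norm (xhat x - x))\<^sup>2"
proof -
  have "0 \<le> M * (norm (xhat x - x))\<^sup>2"
    using M_pos by simp
  then show ?thesis
    using V_step[OF assms prox_in_S, of "G x" "J x" x] by simp
qed

end

section \<open>Summation over the iterations\<close>

text \<open>Telescoping and Cauchy-Schwarz bound the \<open>i\<close>-th term by \<open>i\<close>
  times the full sum of squared steps.\<close>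

lemma sum_sq_dist_from_start_le:
  fixes z :: "nat \<Rightarrow> 'a::real_normed_vector"
  shows "(\<Sum>i<n. (norm (z i - z 0))\<^sup>2) \<le> (real n)\<^sup>2 / 2 * (\<Sum>i<n. (norm (z (Suc i) - z i))\<^sup>2)"
proof -
  define s where "s = (\<Sum>i<n. (norm (z (Suc i) - z i))\<^sup>2)"
  have "(norm (z i - z 0))\<^sup>2 \<le> real i * s" if "i < n" for i
  proof -
    have "norm (z i - z 0) \<le> (\<Sum>j<i. norm (z (Suc j) - z j))"
      using norm_sum[of "\<lambda>j. z (Suc j) - z j" "{..<i}"] by (simp add: sum_lessThan_telescope)
    then have "(norm (z i - z 0))\<^sup>2 \<le> (\<Sum>j<i. norm (z (Suc j) - z j))\<^sup>2"
      by (intro power_mono) auto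
    also have "\<dots> \<le> (\<Sum>j<i. (norm (z (Suc j) - z j))\<^sup>2) * real i"
      using sum_squared_le_sum_of_squares[of _ "{..<i}"] by simp
    also have "\<dots> \<le> s * real i"
      unfolding s_def using that by (intro mult_right_mono sum_mono2) auto
    finally show ?thesis
      by (simp add: mult.commute)
  qed
  then have "(\<Sum>i<n. (norm (z i - z 0))\<^sup>2) \<le> (\<Sum>i<n. real i * s)"
    by (intro sum_mono) auto
  also have "\<dots> = (\<Sum>i<n. real i) * s"
    by (simp add: sum_distrib_right)
  also have "\<dots> \<le> (real n)\<^sup>2 / 2 * s"
  proof (rule mult_right_mono)
    show "(\<Sum>i<n. real i) \<le> (real n)\<^sup>2 / 2"
      by (induction n) (auto simp: power2_eq_square algebra_simps)
    show "0 \<le> s"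
      unfolding s_def by (intro sum_nonneg) auto
  qed
  finally show ?thesis
    by (simp add: s_def)
qed

lemma svr_inner_cong:
  "(\<And>j. j < i \<Longrightarrow> bs j = bs' j) \<Longrightarrow> svr_inner N f h g M a bs i = svr_inner N f h g M a bs' i"
  by (induction i) (auto simp: Let_def)

lemma svr_anchor_cong:
  "(\<And>l j. l \<le> k \<Longrightarrow> j < \<tau> \<Longrightarrow> \<omega> (l, j) = \<omega>' (l, j)) \<Longrightarrow>
    svr_anchor N f h g M \<tau> x0 \<omega> k = svr_anchor N f h g M \<tau> x0 \<omega>' k"
proof (induction k)
  case (Suc k)
  then have "svr_anchor N f h g M \<tau> x0 \<omega> k = svr_anchor N f h g M \<tau> x0 \<omega>' k"
    by simp
  then show ?case
    using Suc.prems by (auto intro!: svr_inner_cong)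
qed simp

locale svr_run = composite_problem f h g N lf M lg Lg
  for f :: "real^'m \<Rightarrow> ereal"
    and h :: "real^'n \<Rightarrow> ereal"
    and g :: "nat \<Rightarrow> real^'n \<Rightarrow> real^'m"
    and N :: nat
    and lf M :: real
    and lg Lg :: "nat \<Rightarrow> real" +
  fixes x0 :: "real^'n"
    and D :: "nat \<times> nat \<Rightarrow> (nat list \<times> nat list) pmf"
    and K :: nat
  assumes x0_in_S: "x0 \<in> edom h"
    and tau_pos: "svr_tau N \<ge> 1"
    and batches: "batch_laws N (svr_tau N) (svr_map_batch N) (svr_jac_batch N) D"
    and K_pos: "K \<ge> 1"
begin

abbreviation "\<tau> \<equiv> svr_tau N"
text \<open>The batches alone, without the output index. Second indices start at 1 because iteration
  0 draws nothing.\<close>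

definition "P = Pi_pmf ({1..K} \<times> {1..<\<tau>}) ([], []) D"
abbreviation "anchor \<omega> k \<equiv> svr_anchor N f h g M \<tau> x0 \<omega> k"
abbreviation "X \<omega> k i \<equiv> svr_iterate N f h g M \<tau> x0 \<omega> k i"
abbreviation "stat x \<equiv> (norm (xhat x - x))\<^sup>2"

lemma inner_in_S: "a \<in> S \<Longrightarrow> svr_inner N f h g M a bs i \<in> S"
  by (induction i) (auto simp: Let_def)

lemma anchor_in_S: "anchor \<omega> k \<in> S"
  by (induction k) (auto simp: x0_in_S inner_in_S)

lemma X_in_S: "X \<omega> k i \<in> S"
  by (simp add: svr_iterate_def inner_in_S anchor_in_S)

lemma X_0: "X \<omega> k 0 = anchor \<omega> (k - 1)"
  by (simp add: svr_iterate_def)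

lemma X_tau: "k \<ge> 1 \<Longrightarrow> X \<omega> k \<tau> = anchor \<omega> k"
  by (cases k) (auto simp: svr_iterate_def)

lemma X_1: "X \<omega> k (Suc 0) = xhat (X \<omega> k 0)"
  by (simp add: svr_iterate_def)

lemma X_Suc:
  assumes "i \<ge> 1"
  shows "X \<omega> k (Suc i) =
    prox (svrg_map_est N g (fst (\<omega> (k, i))) (X \<omega> k 0) (X \<omega> k i))
      (svrg_jac_est N g (snd (\<omega> (k, i))) (X \<omega> k 0) (X \<omega> k i)) (X \<omega> k i)"
  using assms by (simp add: svr_iterate_def Let_def)

text \<open>Batch \<open>(k, j)\<close> is first used for iterate \<open>j + 1\<close> of epoch
  \<open>k\<close>; earlier iterates do not see it.\<close>

lemma X_fun_upd:
  assumes "k \<ge> 1" "i \<le> j"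
  shows "X (fun_upd \<omega> (k, j) b) k i = X \<omega> k i"
proof -
  have "anchor (fun_upd \<omega> (k, j) b) (k - 1) = anchor \<omega> (k - 1)"
    using assms by (intro svr_anchor_cong) auto
  then show ?thesis
    unfolding svr_iterate_def using assms by (auto intro!: svr_inner_cong)
qed

lemma batch_law:
  assumes "c \<in> {1..K} \<times> {1..<\<tau>}"
  shows map_fst_D: "map_pmf fst (D c) = replicate_pmf (svr_map_batch N) (pmf_of_set {1..N})"
    and map_snd_D: "map_pmf snd (D c) = replicate_pmf (svr_jac_batch N) (pmf_of_set {1..N})"
  using assms batches unfolding batch_laws_def by auto

text \<open>Whatever the coupling, the support lies in the product of the finite supports of the
  marginals.\<close>

lemma finite_set_D:
  assumes "c \<in> {1..K} \<times> {1..<\<tau>}"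
  shows "finite (set_pmf (D c))"
proof -
  have "finite (set_pmf (pmf_of_set {1..N}))"
    using N_ge_1 by simp
  then have "finite (fst ` set_pmf (D c))" "finite (snd ` set_pmf (D c))"
    using map_fst_D[OF assms] map_snd_D[OF assms] finite_set_replicate_pmf
    by (metis set_map_pmf)+
  then have "finite (fst ` set_pmf (D c) \<times> snd ` set_pmf (D c))"
    by blast
  then show ?thesis
    by (rule finite_subset[OF subset_fst_snd])
qed

lemma finite_set_P: "finite (set_pmf P)"
  unfolding P_def by (subst set_Pi_pmf) (auto intro!: finite_PiE_dflt finite_set_D)

lemma integrable_P [simp]: "integrable (measure_pmf P) (\<phi> :: _ \<Rightarrow> real)"
  by (rule integrable_measure_pmf_finite[OF finite_set_P])

text \<open>Resampling batch \<open>(k, i)\<close> leaves iterate \<open>i\<close> fixed, so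
  \<open>expected_step\<close> applies for each realization of the other batches.\<close>

lemma iteration_step:
  assumes k: "k \<in> {1..K}" and i: "i < \<tau>"
  shows "measure_pmf.expectation P
      (\<lambda>\<omega>. V (X \<omega> k (Suc i)) + 77/1000 * M * (norm (X \<omega> k (Suc i) - X \<omega> k i))\<^sup>2)
    \<le> measure_pmf.expectation P
      (\<lambda>\<omega>. V (X \<omega> k i) - M / 15 * stat (X \<omega> k i) + 77/125 * M * (norm (X \<omega> k i - X \<omega> k 0) / q)\<^sup>2)"
proof (cases "i = 0")
  case True
  then show ?thesis
    using exact_step[OF X_in_S] by (intro expectation_mono_finite finite_set_P) (simp add: X_1)
next
  case False
  then have c: "(k, i) \<in> {1..K} \<times> {1..<\<tau>}"
    using k i by auto
  define y where "y \<omega> b = prox (svrg_map_est N g (fst b) (X \<omega> k 0) (X \<omega> k i))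
      (svrg_jac_est N g (snd b) (X \<omega> k 0) (X \<omega> k i)) (X \<omega> k i)" for \<omega> b
  have upd: "X (fun_upd \<omega> (k, i) b) k i = X \<omega> k i"
    "X (fun_upd \<omega> (k, i) b) k (Suc i) = y \<omega> b" for \<omega> b
    using k False by (auto simp: X_fun_upd X_Suc y_def)
  have "measure_pmf.expectation P
      (\<lambda>\<omega>. V (X \<omega> k (Suc i)) + 77/1000 * M * (norm (X \<omega> k (Suc i) - X \<omega> k i))\<^sup>2) =
    measure_pmf.expectation P (\<lambda>\<omega>. measure_pmf.expectation (D (k, i))
      (\<lambda>b. V (y \<omega> b) + 77/1000 * M * (norm (y \<omega> b - X \<omega> k i))\<^sup>2))"
    unfolding P_def by (subst expectation_Pi_pmf_resample[OF _ c finite_set_D]) (simp_all add: upd)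
  also have "\<dots> \<le> measure_pmf.expectation P
      (\<lambda>\<omega>. V (X \<omega> k i) - M / 15 * stat (X \<omega> k i) + 77/125 * M * (norm (X \<omega> k i - X \<omega> k 0) / q)\<^sup>2)"
    unfolding y_def
    by (intro expectation_mono_finite finite_set_P expected_step X_in_S map_fst_D map_snd_D
        finite_set_D c)
  finally show ?thesis .
qed

lemma epoch_step:
  assumes k: "k \<in> {1..K}"
  shows "measure_pmf.expectation P (\<lambda>\<omega>. V (anchor \<omega> k)) + M / 15 *
      (\<Sum>i<\<tau>. measure_pmf.expectation P (\<lambda>\<omega>. stat (X \<omega> k i)))
    \<le> measure_pmf.expectation P (\<lambda>\<omega>. V (anchor \<omega> (k - 1)))"
proof -
  define v where "v i = measure_pmf.expectation P (\<lambda>\<omega>. V (X \<omega> k i))" for i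
  define s where "s i = measure_pmf.expectation P (\<lambda>\<omega>. stat (X \<omega> k i))" for i
  define d where "d i = measure_pmf.expectation P (\<lambda>\<omega>. (norm (X \<omega> k (Suc i) - X \<omega> k i))\<^sup>2)" for i
  define r where "r i = measure_pmf.expectation P (\<lambda>\<omega>. (norm (X \<omega> k i - X \<omega> k 0))\<^sup>2)" for i
  have "v (Suc i) - v i \<le> 77/125 * M / q\<^sup>2 * r i - 77/1000 * M * d i - M / 15 * s i" if "i < \<tau>" for i
    using iteration_step[OF k that]
    by (simp add: v_def s_def d_def r_def power_divide)
  then have "(\<Sum>i<\<tau>. v (Suc i) - v i)
      \<le> (\<Sum>i<\<tau>. 77/125 * M / q\<^sup>2 * r i - 77/1000 * M * d i - M / 15 * s i)"
    by (intro sum_mono) auto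
  then have "v \<tau> - v 0 \<le> 77/125 * M / q\<^sup>2 * (\<Sum>i<\<tau>. r i) - 77/1000 * M * (\<Sum>i<\<tau>. d i) - M / 15 * (\<Sum>i<\<tau>. s i)"
    unfolding sum_lessThan_telescope by (simp only: sum_subtractf sum_distrib_left)
  moreover have "77/125 * M / q\<^sup>2 * (\<Sum>i<\<tau>. r i) \<le> 77/1000 * M * (\<Sum>i<\<tau>. d i)"
  proof -
    have "(\<Sum>i<\<tau>. r i) = measure_pmf.expectation P (\<lambda>\<omega>. \<Sum>i<\<tau>. (norm (X \<omega> k i - X \<omega> k 0))\<^sup>2)"
      by (simp add: r_def)
    also have "\<dots> \<le> measure_pmf.expectation P
        (\<lambda>\<omega>. (real \<tau>)\<^sup>2 / 2 * (\<Sum>i<\<tau>. (norm (X \<omega> k (Suc i) - X \<omega> k i))\<^sup>2))"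
      by (intro expectation_mono_finite finite_set_P sum_sq_dist_from_start_le)
    also have "\<dots> = (real \<tau>)\<^sup>2 / 2 * (\<Sum>i<\<tau>. d i)"
      by (simp add: d_def)
    \<comment> \<open>The epoch length is at most \<open>q / 2\<close>, so the drift costs
      \<open>77/125 * 1/8 = 77/1000\<close>, exactly the weight of the squared steps.\<close>
    also have "\<dots> \<le> (q / 2)\<^sup>2 / 2 * (\<Sum>i<\<tau>. d i)"
      using svr_tau_le[OF tau_pos]
      by (intro mult_right_mono divide_right_mono power_mono) (auto simp: d_def intro!: sum_nonneg)
    finally have "77/125 * M / q\<^sup>2 * (\<Sum>i<\<tau>. r i) \<le> 77/125 * M / q\<^sup>2 * ((q / 2)\<^sup>2 / 2 * (\<Sum>i<\<tau>. d i))"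
      using M_pos by (intro mult_left_mono) auto
    then show ?thesis
      using q_pos by (simp add: power_divide)
  qed
  moreover have "v \<tau> = measure_pmf.expectation P (\<lambda>\<omega>. V (anchor \<omega> k))"
    "v 0 = measure_pmf.expectation P (\<lambda>\<omega>. V (anchor \<omega> (k - 1)))"
    using k by (simp_all add: v_def X_tau X_0)
  ultimately show ?thesis
    by (simp add: s_def)
qed

text \<open>The values of \<open>V\<close> telescope over the epochs, from at most
  \<open>\<Phi> x0\<close> to at least \<open>\<Phi>_min\<close>.\<close>

lemma total_stationarity:
  "(\<Sum>k = 1..K. \<Sum>i<\<tau>. measure_pmf.expectation P (\<lambda>\<omega>. stat (X \<omega> k i))) \<le> 15 / M * (\<Phi> x0 - \<Phi>_min)"
proof -
  define w where "w k = measure_pmf.expectation P (\<lambda>\<omega>. V (anchor \<omega> k))" for k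
  define s where "s k = (\<Sum>i<\<tau>. measure_pmf.expectation P (\<lambda>\<omega>. stat (X \<omega> k i)))" for k
  have "(\<Sum>k = 1..K. M / 15 * s k) \<le> (\<Sum>k = 1..K. w (k - 1) - w k)"
    using epoch_step by (intro sum_mono) (simp add: w_def s_def algebra_simps)
  also have "\<dots> = w 0 - w K"
    using sum_telescope''[of 0 K w] by (simp add: sum_negf[symmetric] sum_subtractf)
  also have "\<dots> \<le> \<Phi> x0 - \<Phi>_min"
  proof -
    have "measure_pmf.expectation P (\<lambda>_. \<Phi>_min) \<le> w K"
      unfolding w_def by (intro expectation_mono_finite finite_set_P \<Phi>_min_le_V anchor_in_S)
    moreover have "w 0 \<le> \<Phi> x0"
      using V_le_\<Phi>[OF x0_in_S] by (simp add: w_def)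
    ultimately show ?thesis
      by simp
  qed
  finally have "M / 15 * (\<Sum>k = 1..K. s k) \<le> \<Phi> x0 - \<Phi>_min"
    by (simp only: sum_distrib_left)
  then show ?thesis
    using M_pos by (simp add: s_def field_simps)
qed

text \<open>Averaging over the independent output index turns the expectation into the mean over all
  iterates; the squared gradient mapping is \<open>M\<^sup>2\<close> times
  \<open>stat\<close>.\<close>

lemma expected_sq_grad_map_le:
  "expected_sq_grad_map N f h g M K \<tau> D x0 \<le> 15 * M * (\<Phi> x0 - \<Phi>_min) / (real K * real \<tau>)"
proof -
  let ?I = "{1..K} \<times> {0..<\<tau>}"
  have I: "finite ?I" "?I \<noteq> {}"
    using K_pos tau_pos by auto
  have grad: "(norm (grad_map N f h g M x))\<^sup>2 = M\<^sup>2 * stat x" for x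
    by (simp add: grad_map_def power_mult_distrib norm_minus_commute)
  have "expected_sq_grad_map N f h g M K \<tau> D x0 =
      measure_pmf.expectation P (\<lambda>\<omega>. (\<Sum>(k, i)\<in>?I. M\<^sup>2 * stat (X \<omega> k i)) / real (card ?I))"
    unfolding expected_sq_grad_map_def svr_law_def grad P_def[symmetric]
    by (subst expectation_pair_finite)
      (use I finite_set_P in \<open>simp_all add: integral_pmf_of_set[OF I(2,1)] case_prod_unfold sum_distrib_left del: One_nat_def\<close>)
  also have "\<dots> = M\<^sup>2 / (real K * real \<tau>) *
      (\<Sum>k = 1..K. \<Sum>i<\<tau>. measure_pmf.expectation P (\<lambda>\<omega>. stat (X \<omega> k i)))"
    by (simp add: sum.cartesian_product[symmetric] lessThan_atLeast0 flip: sum_distrib_left)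
  also have "\<dots> \<le> M\<^sup>2 / (real K * real \<tau>) * (15 / M * (\<Phi> x0 - \<Phi>_min))"
    by (intro mult_left_mono total_stationarity) auto
  also have "\<dots> = 15 * M * (\<Phi> x0 - \<Phi>_min) / (real K * real \<tau>)"
    using M_pos by (simp add: power2_eq_square)
  finally show ?thesis .
qed

end

section \<open>Sample complexity\<close>

text \<open>Add \<open>\<tau> \<ge> q/2 - 1\<close> and \<open>\<tau> \<ge> 1\<close>, where
  \<open>\<tau>\<close> is \<open>svr_tau N\<close> and \<open>q\<close> is
  \<open>N powr (1/5)\<close>.\<close>

lemma svr_tau_ge:
  assumes "svr_tau N \<ge> 1"
  shows "real N powr (1/5) / 4 \<le> real (svr_tau N)"
  using assms unfolding svr_tau_def by linarith

lemma powr_fifth_ge_1: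
  assumes "svr_tau N \<ge> 1"
  shows "1 \<le> real N powr (1/5)"
  using svr_tau_le[OF assms] assms by linarith

lemma powr_fifth_powers:
  shows "real N = (real N powr (1/5)) ^ 5" "real N powr (4/5) = (real N powr (1/5)) ^ 4"
    "real N powr (2/5) = (real N powr (1/5))\<^sup>2"
  by (cases "N = 0"; simp add: powr_power)+

text \<open>The summand 2 covers the rounding and the minimum of one epoch.\<close>

lemma svr_epochs_le:
  assumes "svr_tau N \<ge> 1" "\<epsilon> > 0"
  shows "real (svr_epochs N \<Delta> \<epsilon>) \<le> 2 + 60 * \<bar>\<Delta>\<bar> / (real N powr (1/5) * \<epsilon>)"
proof -
  let ?q = "real N powr (1/5)"
  have q: "0 < ?q" "0 < real (svr_tau N)"
    using powr_fifth_ge_1[OF assms(1)] assms(1) by linarith+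
  have "15 * \<Delta> / (real (svr_tau N) * \<epsilon>) \<le> 15 * \<bar>\<Delta>\<bar> / (real (svr_tau N) * \<epsilon>)"
    using assms by (intro divide_right_mono) auto
  also have "\<dots> \<le> 15 * \<bar>\<Delta>\<bar> / (?q / 4 * \<epsilon>)"
    using assms svr_tau_ge[OF assms(1)] q
    by (intro divide_left_mono mult_right_mono mult_pos_pos) auto
  also have "\<dots> = 60 * \<bar>\<Delta>\<bar> / (?q * \<epsilon>)"
    by simp
  finally have "15 * \<Delta> / (real (svr_tau N) * \<epsilon>) \<le> 60 * \<bar>\<Delta>\<bar> / (?q * \<epsilon>)" .
  moreover have "0 \<le> 60 * \<bar>\<Delta>\<bar> / (?q * \<epsilon>)"
    using q assms by simp
  ultimately show ?thesis
    unfolding svr_epochs_def by linarith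
qed

text \<open>An epoch has at most \<open>q/2\<close> sampled iterations of cost at most
  \<open>10 * q ^ 4\<close>, hence \<open>5 * N\<close> evaluations beyond the full pass.\<close>

lemma svr_evals_le:
  assumes "svr_tau N \<ge> 1"
  shows "real (svr_map_evals N K) \<le> 6 * real N * real K"
    and "real (svr_jac_evals N K) \<le> 6 * real N * real K"
proof -
  define q where "q = real N powr (1/5)"
  have q: "1 \<le> q"
    unfolding q_def by (rule powr_fifth_ge_1[OF assms])
  have N: "real N = q ^ 5"
    unfolding q_def by (rule powr_fifth_powers(1))
  have q24: "1 \<le> q\<^sup>2" "q\<^sup>2 \<le> q ^ 4"
    using q by (simp_all add: power_increasing)
  have b: "real (svr_map_batch N) \<le> 5 * q ^ 4"
    using q24 unfolding svr_map_batch_def powr_fifth_powers(2) q_def[symmetric] by linarith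
  have s: "real (svr_jac_batch N) \<le> 2 * q ^ 4"
    using q24 unfolding svr_jac_batch_def powr_fifth_powers(3) q_def[symmetric] by linarith
  have steps: "real (\<Sum>i = 1..<svr_tau N. m) \<le> 5 * real N"
    if "real m \<le> 10 * q ^ 4" for m
  proof -
    have "real (\<Sum>i = 1..<svr_tau N. m) \<le> real (svr_tau N) * real m"
      by (simp add: mult_right_mono)
    also have "\<dots> \<le> q / 2 * (10 * q ^ 4)"
      using that svr_tau_le[OF assms] q by (intro mult_mono) (auto simp: q_def)
    also have "\<dots> = 5 * real N"
      unfolding N by (simp add: eval_nat_numeral)
    finally show ?thesis .
  qed
  \<comment> \<open>The threshold 10 covers \<open>2 * 5\<close> for the maps and
    \<open>5 + 2 * 2\<close> for the Jacobians.\<close>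
  have total: "real (\<Sum>k = 1..K. N + (\<Sum>i = 1..<svr_tau N. m)) \<le> 6 * real N * real K"
    if "real m \<le> 10 * q ^ 4" for m
  proof -
    have "real (\<Sum>k = 1..K. N + (\<Sum>i = 1..<svr_tau N. m)) =
        real K * (real N + real (\<Sum>i = 1..<svr_tau N. m))"
      by simp
    also have "\<dots> \<le> real K * (real N + 5 * real N)"
      using steps[OF that] by (intro mult_left_mono add_left_mono) auto
    also have "\<dots> = 6 * real N * real K"
      by simp
    finally show ?thesis .
  qed
  show "real (svr_map_evals N K) \<le> 6 * real N * real K"
    unfolding svr_map_evals_def by (rule total) (use b in simp)
  show "real (svr_jac_evals N K) \<le> 6 * real N * real K"
    unfolding svr_jac_evals_def by (rule total) (use b s in simp)
qed

text \<open>Each epoch costs \<open>O(N)\<close>, and dividing \<open>N\<close> by \<open>q\<close>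
  leaves \<open>N powr (4/5)\<close>.\<close>

lemma epochs_times_size_le:
  assumes "svr_tau N \<ge> 1" "\<epsilon> > 0"
  shows "6 * real N * real (svr_epochs N \<Delta> \<epsilon>)
    \<le> (12 + 360 * \<bar>\<Delta>\<bar>) * (real N + real N powr (4/5) / \<epsilon>)"
proof -
  define q where "q = real N powr (1/5)"
  have q: "1 \<le> q"
    unfolding q_def by (rule powr_fifth_ge_1[OF assms(1)])
  have N: "real N = q ^ 5" and N4: "real N powr (4/5) = q ^ 4"
    unfolding q_def by (rule powr_fifth_powers)+
  have "6 * real N * real (svr_epochs N \<Delta> \<epsilon>) \<le> 6 * real N * (2 + 60 * \<bar>\<Delta>\<bar> / (q * \<epsilon>))"
    using svr_epochs_le[OF assms] unfolding q_def by (intro mult_left_mono) auto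
  also have "\<dots> = 12 * q ^ 5 + 360 * \<bar>\<Delta>\<bar> * (q ^ 4 / \<epsilon>)"
    unfolding N using q assms by (simp add: field_simps eval_nat_numeral)
  also have "\<dots> \<le> (12 + 360 * \<bar>\<Delta>\<bar>) * (q ^ 5 + q ^ 4 / \<epsilon>)"
    using q assms by (simp add: algebra_simps)
  finally show ?thesis
    unfolding N4 by (simp only: N)
qed

lemma svr_epochs_sufficient:
  assumes "svr_tau N \<ge> 1" "\<epsilon> > 0" "M * \<delta> \<le> \<Delta>"
  shows "15 * M * \<delta> / (real (svr_epochs N \<Delta> \<epsilon>) * real (svr_tau N)) \<le> \<epsilon>"
proof -
  let ?K = "svr_epochs N \<Delta> \<epsilon>"
  have K: "?K \<ge> 1" "15 * \<Delta> / (real (svr_tau N) * \<epsilon>) \<le> real ?K"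
    unfolding svr_epochs_def by linarith+
  have "15 * \<Delta> \<le> real ?K * (real (svr_tau N) * \<epsilon>)"
    using K(2) assms by (subst (asm) pos_divide_le_eq) auto
  then have "15 * M * \<delta> \<le> \<epsilon> * (real ?K * real (svr_tau N))"
    using assms(3) by (simp add: mult_ac)
  then show ?thesis
    using assms K(1) by (subst pos_divide_le_eq) auto
qed

theorem theorem1:
  fixes f :: "real^'m \<Rightarrow> ereal"
    and h :: "real^'n \<Rightarrow> ereal"
    and g :: "nat \<Rightarrow> real^'n \<Rightarrow> real^'m"
    and N :: nat
    and lf M :: real
    and lg Lg :: "nat \<Rightarrow> real"
    and x0 :: "real^'n"
    and D :: "nat \<times> nat \<Rightarrow> (nat list \<times> nat list) pmf"
  assumes f_proper: "\<And>u. f u \<noteq> -\<infinity>"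
    and f_convex: "ereal_convex f"
    and f_lipschitz: "\<And>u v. \<bar>f u - f v\<bar> \<le> ereal (lf * norm (u - v))"
    and h_proper: "\<And>x. h x \<noteq> -\<infinity>"
    and h_convex: "ereal_convex h"
    and h_lsc: "ereal_lsc h"
    and g_smooth: "\<And>j x. j \<in> {1..N} \<Longrightarrow> g j differentiable (at x)"
    and g_lipschitz: "\<And>j x y. j \<in> {1..N} \<Longrightarrow> x \<in> edom h \<Longrightarrow> y \<in> edom h \<Longrightarrow>
          norm (g j x - g j y) \<le> lg j * norm (x - y)"
    and jac_lipschitz: "\<And>j x y. j \<in> {1..N} \<Longrightarrow> x \<in> edom h \<Longrightarrow> y \<in> edom h \<Longrightarrow>
          spectral_norm (jac (g j) x - jac (g j) y) \<le> Lg j * norm (x - y)"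
    and bounded_below: "optimal_value N f h g > -\<infinity>"
    and M_pos: "M > 0"
    and M_ge: "M \<ge> 4 * lf * sqrt (1 / real N * (\<Sum>j = 1..N. (Lg j)\<^sup>2))"
    and tau_pos: "svr_tau N \<ge> 1"
    and batches: "batch_laws N (svr_tau N) (svr_map_batch N) (svr_jac_batch N) D"
  shows
    "(\<forall>K\<ge>1. ereal (expected_sq_grad_map N f h g M K (svr_tau N) D x0)
        \<le> ereal (15 * M) * (objective N f h g x0 - optimal_value N f h g)
            / ereal (real K * real (svr_tau N))) \<and>
     (\<forall>\<epsilon>>0. \<forall>\<Delta>. ereal M * (objective N f h g x0 - optimal_value N f h g) \<le> ereal \<Delta> \<longrightarrow>
        expected_sq_grad_map N f h g M (svr_epochs N \<Delta> \<epsilon>) (svr_tau N) D x0 \<le> \<epsilon>) \<and>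
     (\<forall>\<Delta>. \<exists>C. \<forall>N' \<epsilon>. svr_tau N' \<ge> 1 \<and> \<epsilon> > 0 \<longrightarrow>
        real (svr_map_evals N' (svr_epochs N' \<Delta> \<epsilon>))
          \<le> C * (real N' + real N' powr (4 / 5) / \<epsilon>) \<and>
        real (svr_jac_evals N' (svr_epochs N' \<Delta> \<epsilon>))
          \<le> C * (real N' + real N' powr (4 / 5) / \<epsilon>))"
proof -
  let ?\<tau> = "svr_tau N"
  let ?gap = "objective N f h g x0 - optimal_value N f h g"
  let ?E = "\<lambda>K. expected_sq_grad_map N f h g M K ?\<tau> D x0"
  have N: "N \<ge> 1"
    using powr_fifth_ge_1[OF tau_pos] by (cases "N = 0") auto
  have evals: "\<exists>C. \<forall>N' \<epsilon>. svr_tau N' \<ge> 1 \<and> \<epsilon> > 0 \<longrightarrow>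
        real (svr_map_evals N' (svr_epochs N' \<Delta> \<epsilon>))
          \<le> C * (real N' + real N' powr (4 / 5) / \<epsilon>) \<and>
        real (svr_jac_evals N' (svr_epochs N' \<Delta> \<epsilon>))
          \<le> C * (real N' + real N' powr (4 / 5) / \<epsilon>)" for \<Delta>
    by (intro exI[of _ "12 + 360 * \<bar>\<Delta>\<bar>"] allI impI conjI; elim conjE)
      (blast intro: order_trans[OF svr_evals_le(1) epochs_times_size_le]
        order_trans[OF svr_evals_le(2) epochs_times_size_le])+
  have "(\<forall>K\<ge>1. ereal (?E K) \<le> ereal (15 * M) * ?gap / ereal (real K * real ?\<tau>)) \<and>
     (\<forall>\<epsilon>>0. \<forall>\<Delta>. ereal M * ?gap \<le> ereal \<Delta> \<longrightarrow> ?E (svr_epochs N \<Delta> \<epsilon>) \<le> \<epsilon>)"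
  proof (cases "x0 \<in> edom h")
    case False
    \<comment> \<open>Outside the domain the gap is infinite: the first bound is trivial and no real
      \<open>\<Delta>\<close> dominates \<open>M\<close> times the gap.\<close>
    then have "objective N f h g x0 = \<infinity>"
      using f_proper by (simp add: edom_def objective_def)
    then have gap: "?gap = \<infinity>"
      by simp
    show ?thesis
      unfolding gap using M_pos tau_pos by simp
  next
    case True
    interpret composite_problem f h g N lf M lg Lg
      using assms N True by unfold_locales auto
    have gap: "?gap = ereal (\<Phi> x0 - \<Phi>_min)"
      by (simp add: objective_eq[OF True] optimal_value_eq)
    have bound: "?E K \<le> 15 * M * (\<Phi> x0 - \<Phi>_min) / (real K * real ?\<tau>)" if "K \<ge> 1" for K
    proof -
      interpret svr_run f h g N lf M lg Lg x0 D K
        using True tau_pos batches that by unfold_locales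
      show ?thesis
        by (rule expected_sq_grad_map_le)
    qed
    show ?thesis
      unfolding gap
    proof (intro conjI allI impI)
      fix K :: nat assume "K \<ge> 1"
      then show "ereal (?E K) \<le> ereal (15 * M) * ereal (\<Phi> x0 - \<Phi>_min) / ereal (real K * real ?\<tau>)"
        using bound[of K] tau_pos by simp
    next
      fix \<epsilon> \<Delta> :: real
      assume "\<epsilon> > 0" "ereal M * ereal (\<Phi> x0 - \<Phi>_min) \<le> ereal \<Delta>"
      then have "15 * M * (\<Phi> x0 - \<Phi>_min) / (real (svr_epochs N \<Delta> \<epsilon>) * real ?\<tau>) \<le> \<epsilon>"
        by (intro svr_epochs_sufficient[OF tau_pos]) auto
      moreover have "svr_epochs N \<Delta> \<epsilon> \<ge> 1"
        by (simp add: svr_epochs_def)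
      ultimately show "?E (svr_epochs N \<Delta> \<epsilon>) \<le> \<epsilon>"
        using bound by (meson order_trans)
    qed
  qed
  then show ?thesis
    using evals by blast
qed

end
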